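(* Let $M$ be a monoid that embeds into a group, let $X$ be a set, and let $R$ be a set of admissible identities over $X^*$. Then $\mathcal{FR}_R(M)$ is isomorphic (as a restriction monoid) to the restriction submonoid of $\mathcal{FI}_R(M)$ consisting of the elements $e[m]$ where $e\in E(\mathcal{FI}_R(M))$ and $m\in M$. This is precisely the restriction submonoid of $\mathcal{FI}_R(M)$ generated by $[M]=\{[m]:m\in M\}$. As a monoid, $\mathcal{FR}_R(M)$ (identified with this submonoid) is generated by $E(\mathcal{FI}_R(M))$ and $[M]$.
   Context: Restriction monoids. A restriction semigroup is an algebra $(S;\cdot,{}^*,{}^+)$ with $(S;\cdot)$ a semigroup satisfying $x^+x=x$, $x^+y^+=y^+x^+$, $(x^+y)^+=x^+y^+$, $xy^+=(xy)^+x$; $xx^*=x$, $x^*y^*=y^*x^*$, $(xy^* )^*=x^*y^*$, $x^*y=y(xy)^*$; $(x^+)^*=x^+$, $(x^* )^+=x^*$. A restriction monoid is a restriction semigroup with an identity element, in signature $(\cdot,{}^*,{}^+,1)$; morphisms and submonoids are taken with respect to this signature. Every inverse monoid is a restriction monoid with $s^*=s^{-1}s$, $s^+=ss^{-1}$. $E(S)$ denotes the set of idempotents of an inverse monoid $S$. Identities. $X^*$ is the free monoid on a set $X$ (empty word $\lambda$), and $FR(X^* )$ is the free restriction monoid on the set $X^*$ (its product is written $\cdot$, its identity is $1\neq\lambda$; the generator $uv$ is different from the product $u\cdot v$). For a map $f\colon X\to M$ into a monoid, with monoid-morphism extension $\widehat f\colon X^*\to M$, and a map $\gamma\colon M\to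 S$ into a restriction monoid, the value $[p]_{\gamma,f}\in S$ of $p\in FR(X^* )$ is the image of $p$ under the morphism $FR(X^* )\to S$ sending each generator $u\in X^*$ to $\gamma(\widehat f(u))$. An identity over $X^*$ is an equality $p=q$ with $p,q\in FR(X^* )$; $\gamma$ satisfies it if $[p]_{\gamma,f}=[q]_{\gamma,f}$ for all $f\colon X\to M$. An identity is admissible if every monoid morphism from a monoid to a restriction monoid (i.e. map preserving $1$ and products) satisfies it. Free objects. $\mathcal{FR}_R(M)$ is the restriction monoid generated by the set $\{\lfloor m\rfloor:m\in M\}$ subject to the relations $\lfloor 1\rfloor=1$, $\lfloor m\rfloor\lfloor n\rfloor=\lfloor mn\rfloor(\lfloor m\rfloor\lfloor n\rfloor)^*$ ($m,n\in M$), and $[p]_{\iota,f}=[q]_{\iota,f}$ for all identities $p=q$ in $R$ and all $f\colon X\to M$, where $\iota(m)=\lfloor m\rfloor$. $\mathcal{FI}_R(M)$ is the inverse monoid generated by the set $\{[m]:m\in M\}$ subject to the relations $[1]=1$, $[m][n]=[mn]([m][n])^*$, and $[p]_{\iota,f}=[q]_{\iota,f}$ for all $p=q$ in $R$ and all $f\colon X\to M$, where $\iota(m)=[m]$. *)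

theory Defs
  imports "HOL-Algebra.Group"
begin

section \<open>Restriction monoids\<close>

record 'a restr_monoid = "'a monoid" +
  rstar :: "'a \<Rightarrow> 'a" (\<open>_\<^sup>\<star>\<index>\<close> [1000] 999)
  rplus :: "'a \<Rightarrow> 'a" (\<open>_\<^sup>\<oplus>\<index>\<close> [1000] 999)

locale restriction_monoid = monoid S for S (structure) +
  assumes star_closed: "x \<in> carrier S \<Longrightarrow> x\<^sup>\<star> \<in> carrier S"
    and plus_closed: "x \<in> carrier S \<Longrightarrow> x\<^sup>\<oplus> \<in> carrier S"
    and plus_left: "x \<in> carrier S \<Longrightarrow> x\<^sup>\<oplus> \<otimes> x = x"
    and plus_comm: "\<lbrakk>x \<in> carrier S; y \<in> carrier S\<rbrakk> \<Longrightarrow> x\<^sup>\<oplus> \<otimes> y\<^sup>\<oplus> = y\<^sup>\<oplus> \<otimes> x\<^sup>\<oplus>"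
    and plus_plus: "\<lbrakk>x \<in> carrier S; y \<in> carrier S\<rbrakk> \<Longrightarrow> (x\<^sup>\<oplus> \<otimes> y)\<^sup>\<oplus> = x\<^sup>\<oplus> \<otimes> y\<^sup>\<oplus>"
    and plus_ample: "\<lbrakk>x \<in> carrier S; y \<in> carrier S\<rbrakk> \<Longrightarrow> x \<otimes> y\<^sup>\<oplus> = (x \<otimes> y)\<^sup>\<oplus> \<otimes> x"
    and star_right: "x \<in> carrier S \<Longrightarrow> x \<otimes> x\<^sup>\<star> = x"
    and star_comm: "\<lbrakk>x \<in> carrier S; y \<in> carrier S\<rbrakk> \<Longrightarrow> x\<^sup>\<star> \<otimes> y\<^sup>\<star> = y\<^sup>\<star> \<otimes> x\<^sup>\<star>"
    and star_star: "\<lbrakk>x \<in> carrier S; y \<in> carrier S\<rbrakk> \<Longrightarrow> (x \<otimes> y\<^sup>\<star>)\<^sup>\<star> = x\<^sup>\<star> \<otimes> y\<^sup>\<star>"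
    and star_ample: "\<lbrakk>x \<in> carrier S; y \<in> carrier S\<rbrakk> \<Longrightarrow> x\<^sup>\<star> \<otimes> y = y \<otimes> (x \<otimes> y)\<^sup>\<star>"
    and star_of_plus: "x \<in> carrier S \<Longrightarrow> (x\<^sup>\<oplus>)\<^sup>\<star> = x\<^sup>\<oplus>"
    and plus_of_star: "x \<in> carrier S \<Longrightarrow> (x\<^sup>\<star>)\<^sup>\<oplus> = x\<^sup>\<star>"

definition restr_hom ::
  "('a, 'c) restr_monoid_scheme \<Rightarrow> ('b, 'd) restr_monoid_scheme \<Rightarrow> ('a \<Rightarrow> 'b) set" where
  "restr_hom S T = {h \<in> hom S T. h \<one>\<^bsub>S\<^esub> = \<one>\<^bsub>T\<^esub> \<and>
     (\<forall>x\<in>carrier S. h (x\<^sup>\<star>\<^bsub>S\<^esub>) = (h x)\<^sup>\<star>\<^bsub>T\<^esub> \<and> h (x\<^sup>\<oplus>\<^bsub>S\<^esub>) = (h x)\<^sup>\<oplus>\<^bsub>T\<^esub>)}"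

definition restr_isomorphic ::
  "('a, 'c) restr_monoid_scheme \<Rightarrow> ('b, 'd) restr_monoid_scheme \<Rightarrow> bool" where
  "restr_isomorphic S T \<longleftrightarrow> (\<exists>h \<in> restr_hom S T. bij_betw h (carrier S) (carrier T))"

locale restriction_submonoid = submonoid H S for H and S (structure) +
  assumes star_in: "x \<in> H \<Longrightarrow> x\<^sup>\<star> \<in> H"
    and plus_in: "x \<in> H \<Longrightarrow> x\<^sup>\<oplus> \<in> H"

definition restr_generated :: "('a, 'c) restr_monoid_scheme \<Rightarrow> 'a set \<Rightarrow> 'a set" where
  "restr_generated S Y = \<Inter>{H. restriction_submonoid H S \<and> Y \<subseteq> H}"

definition monoid_generated :: "('a, 'c) monoid_scheme \<Rightarrow> 'a set \<Rightarrow> 'a set" where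
  "monoid_generated S Y = \<Inter>{H. submonoid H S \<and> Y \<subseteq> H}"

definition idempotents :: "('a, 'c) monoid_scheme \<Rightarrow> 'a set" where
  "idempotents S = {e \<in> carrier S. e \<otimes>\<^bsub>S\<^esub> e = e}"


section \<open>Free and presented restriction monoids\<close>

definition restr_congruence :: "('a, 'c) restr_monoid_scheme \<Rightarrow> 'a rel \<Rightarrow> bool" where
  "restr_congruence S \<rho> \<longleftrightarrow> equiv (carrier S) \<rho> \<and>
     (\<forall>x x' y y'. (x, x') \<in> \<rho> \<longrightarrow> (y, y') \<in> \<rho> \<longrightarrow> (x \<otimes>\<^bsub>S\<^esub> y, x' \<otimes>\<^bsub>S\<^esub> y') \<in> \<rho>) \<and>
     (\<forall>x x'. (x, x') \<in> \<rho> \<longrightarrow> (x\<^sup>\<star>\<^bsub>S\<^esub>, x'\<^sup>\<star>\<^bsub>S\<^esub>) \<in> \<rho> \<and> (x\<^sup>\<oplus>\<^bsub>S\<^esub>, x'\<^sup>\<oplus>\<^bsub>S\<^esub>) \<in> \<rho>)"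

definition restr_quot :: "('a, 'c) restr_monoid_scheme \<Rightarrow> 'a rel \<Rightarrow> 'a set restr_monoid" where
  "restr_quot S \<rho> = \<lparr>carrier = carrier S // \<rho>,
     mult = (\<lambda>a b. \<Union>x\<in>a. \<Union>y\<in>b. \<rho> `` {x \<otimes>\<^bsub>S\<^esub> y}),
     one = \<rho> `` {\<one>\<^bsub>S\<^esub>},
     rstar = (\<lambda>a. \<Union>x\<in>a. \<rho> `` {x\<^sup>\<star>\<^bsub>S\<^esub>}),
     rplus = (\<lambda>a. \<Union>x\<in>a. \<rho> `` {x\<^sup>\<oplus>\<^bsub>S\<^esub>})\<rparr>"

text \<open>
  The least congruence containing \<open>Rel\<close> whose quotient is a restriction monoid. The
  algebra \<open>S\<close> need not itself be a restriction monoid: for the algebra of terms and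
  \<open>Rel = {}\<close> the quotient is the free restriction monoid, and for \<open>S\<close> a free restriction
  monoid the quotient is the restriction monoid presented by \<open>Rel\<close>.
\<close>

definition restr_cong_gen :: "('a, 'c) restr_monoid_scheme \<Rightarrow> 'a rel \<Rightarrow> 'a rel" where
  "restr_cong_gen S Rel =
     \<Inter>{\<rho>. restr_congruence S \<rho> \<and> restriction_monoid (restr_quot S \<rho>) \<and> Rel \<subseteq> \<rho>}"

datatype 'a rterm =
    RGen 'a
  | ROne
  | RMult "'a rterm" "'a rterm"
  | RStar "'a rterm"
  | RPlus "'a rterm"

definition rterm_algebra :: "'a set \<Rightarrow> 'a rterm restr_monoid" where
  "rterm_algebra A = \<lparr>carrier = {t. set_rterm t \<subseteq> A}, mult = RMult, one = ROne,
     rstar = RStar, rplus = RPlus\<rparr>"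

definition FR :: "'a set \<Rightarrow> 'a rterm set restr_monoid" where
  "FR A = restr_quot (rterm_algebra A) (restr_cong_gen (rterm_algebra A) {})"

definition FR_gen :: "'a set \<Rightarrow> 'a \<Rightarrow> 'a rterm set" where
  "FR_gen A a = restr_cong_gen (rterm_algebra A) {} `` {RGen a}"

text \<open>
  \<open>FR_value A S g\<close> is the unique extension of \<open>g\<close> to a morphism \<open>FR A \<rightarrow> S\<close>; see \<open>FR_value_eq\<close> for
  well-definedness on \<open>carrier (FR A)\<close>.
\<close>

definition FR_value ::
  "'a set \<Rightarrow> ('b, 'c) restr_monoid_scheme \<Rightarrow> ('a \<Rightarrow> 'b) \<Rightarrow> 'a rterm set \<Rightarrow> 'b" where
  "FR_value A S g p =
     (THE s. \<exists>h \<in> restr_hom (FR A) S. (\<forall>a\<in>A. h (FR_gen A a) = g a) \<and> h p = s)"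


section \<open>Inverse monoids\<close>

record 'a inv_monoid = "'a monoid" +
  ginv :: "'a \<Rightarrow> 'a" (\<open>_\<^sup>\<dagger>\<index>\<close> [1000] 999)

locale inverse_monoid = monoid S for S (structure) +
  assumes ginv_closed: "x \<in> carrier S \<Longrightarrow> x\<^sup>\<dagger> \<in> carrier S"
    and ginv_regular: "x \<in> carrier S \<Longrightarrow> x \<otimes> x\<^sup>\<dagger> \<otimes> x = x"
    and ginv_regular': "x \<in> carrier S \<Longrightarrow> x\<^sup>\<dagger> \<otimes> x \<otimes> x\<^sup>\<dagger> = x\<^sup>\<dagger>"
    and ginv_unique: "\<lbrakk>x \<in> carrier S; y \<in> carrier S; x \<otimes> y \<otimes> x = x; y \<otimes> x \<otimes> y = y\<rbrakk>
      \<Longrightarrow> y = x\<^sup>\<dagger>"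

definition restr_of_inv :: "('a, 'c) inv_monoid_scheme \<Rightarrow> 'a restr_monoid" where
  "restr_of_inv S = \<lparr>carrier = carrier S, mult = mult S, one = one S,
     rstar = (\<lambda>x. x\<^sup>\<dagger>\<^bsub>S\<^esub> \<otimes>\<^bsub>S\<^esub> x), rplus = (\<lambda>x. x \<otimes>\<^bsub>S\<^esub> x\<^sup>\<dagger>\<^bsub>S\<^esub>)\<rparr>"

definition inv_congruence :: "('a, 'c) inv_monoid_scheme \<Rightarrow> 'a rel \<Rightarrow> bool" where
  "inv_congruence S \<rho> \<longleftrightarrow> equiv (carrier S) \<rho> \<and>
     (\<forall>x x' y y'. (x, x') \<in> \<rho> \<longrightarrow> (y, y') \<in> \<rho> \<longrightarrow> (x \<otimes>\<^bsub>S\<^esub> y, x' \<otimes>\<^bsub>S\<^esub> y') \<in> \<rho>) \<and>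
     (\<forall>x x'. (x, x') \<in> \<rho> \<longrightarrow> (x\<^sup>\<dagger>\<^bsub>S\<^esub>, x'\<^sup>\<dagger>\<^bsub>S\<^esub>) \<in> \<rho>)"

definition inv_quot :: "('a, 'c) inv_monoid_scheme \<Rightarrow> 'a rel \<Rightarrow> 'a set inv_monoid" where
  "inv_quot S \<rho> = \<lparr>carrier = carrier S // \<rho>,
     mult = (\<lambda>a b. \<Union>x\<in>a. \<Union>y\<in>b. \<rho> `` {x \<otimes>\<^bsub>S\<^esub> y}),
     one = \<rho> `` {\<one>\<^bsub>S\<^esub>},
     ginv = (\<lambda>a. \<Union>x\<in>a. \<rho> `` {x\<^sup>\<dagger>\<^bsub>S\<^esub>})\<rparr>"

definition inv_cong_gen :: "('a, 'c) inv_monoid_scheme \<Rightarrow> 'a rel \<Rightarrow> 'a rel" where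
  "inv_cong_gen S Rel =
     \<Inter>{\<rho>. inv_congruence S \<rho> \<and> inverse_monoid (inv_quot S \<rho>) \<and> Rel \<subseteq> \<rho>}"

datatype 'a iterm =
    IGen 'a
  | IOne
  | IMult "'a iterm" "'a iterm"
  | IInv "'a iterm"

definition iterm_algebra :: "'a set \<Rightarrow> 'a iterm inv_monoid" where
  "iterm_algebra A = \<lparr>carrier = {t. set_iterm t \<subseteq> A}, mult = IMult, one = IOne, ginv = IInv\<rparr>"

definition FI :: "'a set \<Rightarrow> 'a iterm set inv_monoid" where
  "FI A = inv_quot (iterm_algebra A) (inv_cong_gen (iterm_algebra A) {})"

definition FI_gen :: "'a set \<Rightarrow> 'a \<Rightarrow> 'a iterm set" where
  "FI_gen A a = inv_cong_gen (iterm_algebra A) {} `` {IGen a}"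


section \<open>Identities\<close>

text \<open>
  Words over \<open>X\<close> are lists. An identity over \<open>X\<^sup>*\<close> is a pair of elements of \<open>FR (lists X)\<close>;
  the generator of the empty word is \<open>FR_gen (lists X) []\<close>, which is not the identity element.
\<close>

type_synonym 'x identity = "'x list rterm set \<times> 'x list rterm set"

definition identities :: "'x set \<Rightarrow> 'x identity set" where
  "identities X = carrier (FR (lists X)) \<times> carrier (FR (lists X))"

definition word_ext :: "('m, 'c) monoid_scheme \<Rightarrow> ('x \<Rightarrow> 'm) \<Rightarrow> 'x list \<Rightarrow> 'm" where
  "word_ext M f w = foldr (\<lambda>x m. f x \<otimes>\<^bsub>M\<^esub> m) w \<one>\<^bsub>M\<^esub>"

definition id_value :: "'x set \<Rightarrow> ('m, 'c) monoid_scheme \<Rightarrow> ('s, 'd) restr_monoid_scheme \<Rightarrow>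
    ('m \<Rightarrow> 's) \<Rightarrow> ('x \<Rightarrow> 'm) \<Rightarrow> 'x list rterm set \<Rightarrow> 's" where
  "id_value X M S \<gamma> f p = FR_value (lists X) S (\<lambda>u. \<gamma> (word_ext M f u)) p"

definition satisfies :: "'x set \<Rightarrow> ('m, 'c) monoid_scheme \<Rightarrow> ('s, 'd) restr_monoid_scheme \<Rightarrow>
    ('m \<Rightarrow> 's) \<Rightarrow> 'x identity \<Rightarrow> bool" where
  "satisfies X M S \<gamma> = (\<lambda>(p, q). \<forall>f \<in> X \<rightarrow> carrier M. id_value X M S \<gamma> f p = id_value X M S \<gamma> f q)"

text \<open>
  Admissibility speaks about all monoids and all restriction monoids, but a formula cannot
  quantify over types. The definition ranges over all monoids with carrier in \<open>'x list\<close> and all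
  restriction monoids with carrier in \<open>'x rterm set\<close>; these types are large enough for this to
  be the same as ranging over all types, which is the content of the lemma \<open>admissible_satisfies\<close>
  below.
\<close>

definition admissible :: "'x set \<Rightarrow> 'x identity \<Rightarrow> bool" where
  "admissible X pq \<longleftrightarrow>
     (\<forall>(M :: 'x list monoid) (S :: 'x rterm set restr_monoid) \<gamma>.
        monoid M \<longrightarrow> restriction_monoid S \<longrightarrow> \<gamma> \<in> hom M S \<longrightarrow> \<gamma> \<one>\<^bsub>M\<^esub> = \<one>\<^bsub>S\<^esub> \<longrightarrow> satisfies X M S \<gamma> pq)"


section \<open>The monoids \<open>FR\<^sub>R(M)\<close> and \<open>FI\<^sub>R(M)\<close>\<close>

definition premorphism_rel :: "('m, 'c) monoid_scheme \<Rightarrow> ('s, 'd) restr_monoid_scheme \<Rightarrow>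
    ('m \<Rightarrow> 's) \<Rightarrow> 's rel" where
  "premorphism_rel M S \<iota> = {(\<iota> \<one>\<^bsub>M\<^esub>, \<one>\<^bsub>S\<^esub>)} \<union>
     {(\<iota> m \<otimes>\<^bsub>S\<^esub> \<iota> n, \<iota> (m \<otimes>\<^bsub>M\<^esub> n) \<otimes>\<^bsub>S\<^esub> (\<iota> m \<otimes>\<^bsub>S\<^esub> \<iota> n)\<^sup>\<star>\<^bsub>S\<^esub>) | m n. m \<in> carrier M \<and> n \<in> carrier M}"

definition identity_rel :: "'x set \<Rightarrow> 'x identity set \<Rightarrow> ('m, 'c) monoid_scheme \<Rightarrow>
    ('s, 'd) restr_monoid_scheme \<Rightarrow> ('m \<Rightarrow> 's) \<Rightarrow> 's rel" where
  "identity_rel X R M S \<iota> =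
     {(id_value X M S \<iota> f p, id_value X M S \<iota> f q) | f p q. (p, q) \<in> R \<and> f \<in> X \<rightarrow> carrier M}"

text \<open>The defining relations live in the free objects \<open>FR (carrier M)\<close> and \<open>FI (carrier M)\<close>.\<close>

definition FRR_cong ::
  "'x set \<Rightarrow> 'x identity set \<Rightarrow> ('m, 'c) monoid_scheme \<Rightarrow> 'm rterm set rel" where
  "FRR_cong X R M = (let F = FR (carrier M); \<iota> = FR_gen (carrier M) in
     restr_cong_gen F (premorphism_rel M F \<iota> \<union> identity_rel X R M F \<iota>))"

definition FRR ::
  "'x set \<Rightarrow> 'x identity set \<Rightarrow> ('m, 'c) monoid_scheme \<Rightarrow> 'm rterm set set restr_monoid" where
  "FRR X R M = restr_quot (FR (carrier M)) (FRR_cong X R M)"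

definition FIR_cong ::
  "'x set \<Rightarrow> 'x identity set \<Rightarrow> ('m, 'c) monoid_scheme \<Rightarrow> 'm iterm set rel" where
  "FIR_cong X R M = (let F = FI (carrier M); F' = restr_of_inv F; \<iota> = FI_gen (carrier M) in
     inv_cong_gen F (premorphism_rel M F' \<iota> \<union> identity_rel X R M F' \<iota>))"

definition FIR ::
  "'x set \<Rightarrow> 'x identity set \<Rightarrow> ('m, 'c) monoid_scheme \<Rightarrow> 'm iterm set set inv_monoid" where
  "FIR X R M = inv_quot (FI (carrier M)) (FIR_cong X R M)"

definition FIR_gen :: "'x set \<Rightarrow> 'x identity set \<Rightarrow> ('m, 'c) monoid_scheme \<Rightarrow>
    'm \<Rightarrow> 'm iterm set set" where
  "FIR_gen X R M m = FIR_cong X R M `` {FI_gen (carrier M) m}"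

section \<open>Universal property and admissibility\<close>

lemma restr_quot_simps:
  assumes \<rho>: "restr_congruence S \<rho>"
  shows "x \<in> carrier S \<Longrightarrow> y \<in> carrier S \<Longrightarrow> \<rho> `` {x} \<otimes>\<^bsub>restr_quot S \<rho>\<^esub> \<rho> `` {y} = \<rho> `` {x \<otimes>\<^bsub>S\<^esub> y}"
    and "\<one>\<^bsub>restr_quot S \<rho>\<^esub> = \<rho> `` {\<one>\<^bsub>S\<^esub>}"
    and "x \<in> carrier S \<Longrightarrow> (\<rho> `` {x})\<^sup>\<star>\<^bsub>restr_quot S \<rho>\<^esub> = \<rho> `` {x\<^sup>\<star>\<^bsub>S\<^esub>}"
    and "x \<in> carrier S \<Longrightarrow> (\<rho> `` {x})\<^sup>\<oplus>\<^bsub>restr_quot S \<rho>\<^esub> = \<rho> `` {x\<^sup>\<oplus>\<^bsub>S\<^esub>}"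
    and "carrier (restr_quot S \<rho>) = (\<lambda>x. \<rho> `` {x}) ` carrier S"
proof -
  have eq: "equiv (carrier S) \<rho>" using \<rho> by (simp add: restr_congruence_def)
  have cl: "\<rho> `` {a} = \<rho> `` {b}" if "(a, b) \<in> \<rho>" for a b
    using equiv_class_eq[OF eq that] .
  show "\<rho> `` {x} \<otimes>\<^bsub>restr_quot S \<rho>\<^esub> \<rho> `` {y} = \<rho> `` {x \<otimes>\<^bsub>S\<^esub> y}"
    if "x \<in> carrier S" "y \<in> carrier S"
  proof -
    have "congruent2 \<rho> \<rho> (\<lambda>x y. \<rho> `` {x \<otimes>\<^bsub>S\<^esub> y})"
      using \<rho> by (auto intro!: congruent2I' cl simp: restr_congruence_def)
    from UN_equiv_class2[OF eq eq this that] show ?thesis by (simp add: restr_quot_def)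
  qed
  show "(\<rho> `` {x})\<^sup>\<star>\<^bsub>restr_quot S \<rho>\<^esub> = \<rho> `` {x\<^sup>\<star>\<^bsub>S\<^esub>}" if "x \<in> carrier S"
  proof -
    have "congruent \<rho> (\<lambda>x. \<rho> `` {x\<^sup>\<star>\<^bsub>S\<^esub>})"
      using \<rho> by (auto intro!: congruentI cl simp: restr_congruence_def)
    from UN_equiv_class[OF eq this that] show ?thesis by (simp add: restr_quot_def)
  qed
  show "(\<rho> `` {x})\<^sup>\<oplus>\<^bsub>restr_quot S \<rho>\<^esub> = \<rho> `` {x\<^sup>\<oplus>\<^bsub>S\<^esub>}" if "x \<in> carrier S"
  proof -
    have "congruent \<rho> (\<lambda>x. \<rho> `` {x\<^sup>\<oplus>\<^bsub>S\<^esub>})"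
      using \<rho> by (auto intro!: congruentI cl simp: restr_congruence_def)
    from UN_equiv_class[OF eq this that] show ?thesis by (simp add: restr_quot_def)
  qed
qed (auto simp: restr_quot_def quotient_def)

definition restr_closed :: "('a, 'c) restr_monoid_scheme \<Rightarrow> bool" where
  "restr_closed S \<longleftrightarrow> \<one>\<^bsub>S\<^esub> \<in> carrier S \<and>
     (\<forall>x\<in>carrier S. \<forall>y\<in>carrier S. x \<otimes>\<^bsub>S\<^esub> y \<in> carrier S) \<and>
     (\<forall>x\<in>carrier S. x\<^sup>\<star>\<^bsub>S\<^esub> \<in> carrier S \<and> x\<^sup>\<oplus>\<^bsub>S\<^esub> \<in> carrier S)"

lemma restriction_monoid_closed: "restriction_monoid S \<Longrightarrow> restr_closed S"
  unfolding restr_closed_def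
  by (simp add: restriction_monoid.star_closed restriction_monoid.plus_closed
      restriction_monoid.axioms(1) monoid.m_closed monoid.one_closed)

lemma restr_closed_rterm_algebra: "restr_closed (rterm_algebra A)"
  by (auto simp: restr_closed_def rterm_algebra_def)

definition restr_ax_pairs :: "('a, 'c) restr_monoid_scheme \<Rightarrow> 'a rel" where
  "restr_ax_pairs S = (let m = mult S; s = rstar S; p = rplus S; C = carrier S in
     {(m (m x y) z, m x (m y z)) | x y z. x \<in> C \<and> y \<in> C \<and> z \<in> C} \<union>
     (\<Union>x\<in>C. {(m (one S) x, x), (m x (one S), x), (m (p x) x, x), (m x (s x), x),
        (s (p x), p x), (p (s x), s x)}) \<union>
     (\<Union>x\<in>C. \<Union>y\<in>C. {(m (p x) (p y), m (p y) (p x)), (p (m (p x) y), m (p x) (p y)),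
        (m x (p y), m (p (m x y)) x), (m (s x) (s y), m (s y) (s x)),
        (s (m x (s y)), m (s x) (s y)), (m (s x) y, m y (s (m x y)))}))"

lemma restriction_monoid_quot_iff:
  assumes \<rho>: "restr_congruence S \<rho>" and S: "restr_closed S"
  shows "restriction_monoid (restr_quot S \<rho>) \<longleftrightarrow> restr_ax_pairs S \<subseteq> \<rho>"
proof -
  have eq: "equiv (carrier S) \<rho>" using \<rho> by (simp add: restr_congruence_def)
  have cl: "(\<rho> `` {a} = \<rho> `` {b}) \<longleftrightarrow> (a, b) \<in> \<rho>" if "a \<in> carrier S" "b \<in> carrier S" for a b
    using eq_equiv_class_iff[OF eq that] .
  have [simp]: "x \<otimes>\<^bsub>S\<^esub> y \<in> carrier S" if "x \<in> carrier S" "y \<in> carrier S" for x y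
    using S that by (simp add: restr_closed_def)
  have [simp]: "\<one>\<^bsub>S\<^esub> \<in> carrier S" using S by (simp add: restr_closed_def)
  have [simp]: "x\<^sup>\<star>\<^bsub>S\<^esub> \<in> carrier S" "x\<^sup>\<oplus>\<^bsub>S\<^esub> \<in> carrier S" if "x \<in> carrier S" for x
    using S that by (simp_all add: restr_closed_def)
  note q = restr_quot_simps[OF \<rho>]
  show ?thesis
  proof
    assume "restriction_monoid (restr_quot S \<rho>)"
    then interpret Q: restriction_monoid "restr_quot S \<rho>" .
    have c: "\<rho> `` {x} \<in> carrier (restr_quot S \<rho>)" if "x \<in> carrier S" for x
      using that by (simp add: q)
    show "restr_ax_pairs S \<subseteq> \<rho>"
      unfolding restr_ax_pairs_def Let_def
    proof (intro Un_least UN_least)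
      show "{((x \<otimes>\<^bsub>S\<^esub> y) \<otimes>\<^bsub>S\<^esub> z, x \<otimes>\<^bsub>S\<^esub> (y \<otimes>\<^bsub>S\<^esub> z)) | x y z.
          x \<in> carrier S \<and> y \<in> carrier S \<and> z \<in> carrier S} \<subseteq> \<rho>"
        using Q.m_assoc[OF c c c] by (auto simp: q cl)
    next
      fix x assume x: "x \<in> carrier S"
      show "{(\<one>\<^bsub>S\<^esub> \<otimes>\<^bsub>S\<^esub> x, x), (x \<otimes>\<^bsub>S\<^esub> \<one>\<^bsub>S\<^esub>, x), (x\<^sup>\<oplus>\<^bsub>S\<^esub> \<otimes>\<^bsub>S\<^esub> x, x), (x \<otimes>\<^bsub>S\<^esub> x\<^sup>\<star>\<^bsub>S\<^esub>, x),
        ((x\<^sup>\<oplus>\<^bsub>S\<^esub>)\<^sup>\<star>\<^bsub>S\<^esub>, x\<^sup>\<oplus>\<^bsub>S\<^esub>), ((x\<^sup>\<star>\<^bsub>S\<^esub>)\<^sup>\<oplus>\<^bsub>S\<^esub>, x\<^sup>\<star>\<^bsub>S\<^esub>)} \<subseteq> \<rho>"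
        using Q.l_one[OF c[OF x]] Q.r_one[OF c[OF x]] Q.plus_left[OF c[OF x]] Q.star_right[OF c[OF x]]
          Q.star_of_plus[OF c[OF x]] Q.plus_of_star[OF c[OF x]] x
        by (simp add: q cl)
    next
      fix x y assume x: "x \<in> carrier S" and y: "y \<in> carrier S"
      show "{(x\<^sup>\<oplus>\<^bsub>S\<^esub> \<otimes>\<^bsub>S\<^esub> y\<^sup>\<oplus>\<^bsub>S\<^esub>, y\<^sup>\<oplus>\<^bsub>S\<^esub> \<otimes>\<^bsub>S\<^esub> x\<^sup>\<oplus>\<^bsub>S\<^esub>),
        ((x\<^sup>\<oplus>\<^bsub>S\<^esub> \<otimes>\<^bsub>S\<^esub> y)\<^sup>\<oplus>\<^bsub>S\<^esub>, x\<^sup>\<oplus>\<^bsub>S\<^esub> \<otimes>\<^bsub>S\<^esub> y\<^sup>\<oplus>\<^bsub>S\<^esub>),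
        (x \<otimes>\<^bsub>S\<^esub> y\<^sup>\<oplus>\<^bsub>S\<^esub>, (x \<otimes>\<^bsub>S\<^esub> y)\<^sup>\<oplus>\<^bsub>S\<^esub> \<otimes>\<^bsub>S\<^esub> x), (x\<^sup>\<star>\<^bsub>S\<^esub> \<otimes>\<^bsub>S\<^esub> y\<^sup>\<star>\<^bsub>S\<^esub>, y\<^sup>\<star>\<^bsub>S\<^esub> \<otimes>\<^bsub>S\<^esub> x\<^sup>\<star>\<^bsub>S\<^esub>),
        ((x \<otimes>\<^bsub>S\<^esub> y\<^sup>\<star>\<^bsub>S\<^esub>)\<^sup>\<star>\<^bsub>S\<^esub>, x\<^sup>\<star>\<^bsub>S\<^esub> \<otimes>\<^bsub>S\<^esub> y\<^sup>\<star>\<^bsub>S\<^esub>),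
        (x\<^sup>\<star>\<^bsub>S\<^esub> \<otimes>\<^bsub>S\<^esub> y, y \<otimes>\<^bsub>S\<^esub> (x \<otimes>\<^bsub>S\<^esub> y)\<^sup>\<star>\<^bsub>S\<^esub>)} \<subseteq> \<rho>"
        using Q.plus_comm[OF c[OF x] c[OF y]] Q.plus_plus[OF c[OF x] c[OF y]]
          Q.plus_ample[OF c[OF x] c[OF y]] Q.star_comm[OF c[OF x] c[OF y]]
          Q.star_star[OF c[OF x] c[OF y]] Q.star_ample[OF c[OF x] c[OF y]] x y
        by (simp add: q cl)
    qed
  next
    assume sub: "restr_ax_pairs S \<subseteq> \<rho>"
    have e: "\<rho> `` {a} = \<rho> `` {b}" if "(a, b) \<in> restr_ax_pairs S" for a b
      using equiv_class_eq[OF eq] sub that by blast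
    have assoc: "\<rho> `` {x \<otimes>\<^bsub>S\<^esub> y \<otimes>\<^bsub>S\<^esub> z} = \<rho> `` {x \<otimes>\<^bsub>S\<^esub> (y \<otimes>\<^bsub>S\<^esub> z)}"
      if "x \<in> carrier S" "y \<in> carrier S" "z \<in> carrier S" for x y z
      by (rule e) (use that in \<open>unfold restr_ax_pairs_def Let_def, blast\<close>)
    have unit: "\<rho> `` {\<one>\<^bsub>S\<^esub> \<otimes>\<^bsub>S\<^esub> x} = \<rho> `` {x}" "\<rho> `` {x \<otimes>\<^bsub>S\<^esub> \<one>\<^bsub>S\<^esub>} = \<rho> `` {x}"
      if "x \<in> carrier S" for x
      by (rule e; use that in \<open>unfold restr_ax_pairs_def Let_def, blast\<close>)+
    have "monoid (restr_quot S \<rho>)"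
      by (rule monoidI) (auto simp: q assoc unit)
    moreover have "restriction_monoid_axioms (restr_quot S \<rho>)"
      by (rule restriction_monoid_axioms.intro; clarsimp simp: q)
        (rule imageI, simp | rule e, unfold restr_ax_pairs_def Let_def, blast)+
    ultimately show "restriction_monoid (restr_quot S \<rho>)" by (rule restriction_monoid.intro)
  qed
qed

lemma restr_cong_gen_props:
  assumes S: "restr_closed S" and Rel: "Rel \<subseteq> carrier S \<times> carrier S"
  shows "restr_congruence S (restr_cong_gen S Rel)"
    and "restriction_monoid (restr_quot S (restr_cong_gen S Rel))"
    and "Rel \<subseteq> restr_cong_gen S Rel"
proof -
  define \<C> where "\<C> = {\<rho>. restr_congruence S \<rho> \<and> restr_ax_pairs S \<subseteq> \<rho> \<and> Rel \<subseteq> \<rho>}"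
  have gen: "restr_cong_gen S Rel = \<Inter>\<C>"
    unfolding restr_cong_gen_def \<C>_def using restriction_monoid_quot_iff[OF _ S] by metis
  have "restr_ax_pairs S \<subseteq> carrier S \<times> carrier S"
    using S unfolding restr_ax_pairs_def restr_closed_def Let_def by auto
  moreover have "restr_congruence S (carrier S \<times> carrier S)"
    using S unfolding restr_congruence_def restr_closed_def
    by (auto simp: equiv_def refl_on_def sym_def trans_def)
  ultimately have top: "carrier S \<times> carrier S \<in> \<C>" using Rel by (simp add: \<C>_def)
  show c: "restr_congruence S (restr_cong_gen S Rel)"
    unfolding restr_congruence_def
  proof (intro conjI)
    have eq: "equiv (carrier S) \<rho>" if "\<rho> \<in> \<C>" for \<rho>
      using that by (simp add: \<C>_def restr_congruence_def)
    have "\<Inter>\<C> \<subseteq> carrier S \<times> carrier S" using top by blast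
    moreover have "refl_on (carrier S) (\<Inter>\<C>)"
      using eq by (auto simp: equiv_def refl_on_def)
    moreover have "sym (\<Inter>\<C>)" using eq by (meson InterE InterI equiv_def sym_def)
    moreover have "trans (\<Inter>\<C>)" using eq by (meson InterE InterI equiv_def trans_def)
    ultimately show "equiv (carrier S) (restr_cong_gen S Rel)"
      unfolding gen by (rule equivI)
  qed (auto simp: gen \<C>_def restr_congruence_def)
  show "Rel \<subseteq> restr_cong_gen S Rel" by (auto simp: gen \<C>_def)
  show "restriction_monoid (restr_quot S (restr_cong_gen S Rel))"
    unfolding restriction_monoid_quot_iff[OF c S] by (auto simp: gen \<C>_def)
qed

lemmas FR_cong_props = restr_cong_gen_props[OF restr_closed_rterm_algebra empty_subsetI]

lemma restriction_monoid_FR: "restriction_monoid (FR A)"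
  unfolding FR_def by (rule FR_cong_props(2))

primrec rterm_eval :: "('s, 'd) restr_monoid_scheme \<Rightarrow> ('a \<Rightarrow> 's) \<Rightarrow> 'a rterm \<Rightarrow> 's" where
  "rterm_eval S g (RGen a) = g a"
| "rterm_eval S g ROne = \<one>\<^bsub>S\<^esub>"
| "rterm_eval S g (RMult s t) = rterm_eval S g s \<otimes>\<^bsub>S\<^esub> rterm_eval S g t"
| "rterm_eval S g (RStar t) = (rterm_eval S g t)\<^sup>\<star>\<^bsub>S\<^esub>"
| "rterm_eval S g (RPlus t) = (rterm_eval S g t)\<^sup>\<oplus>\<^bsub>S\<^esub>"

abbreviation FR_class :: "'a set \<Rightarrow> 'a rterm \<Rightarrow> 'a rterm set" where
  "FR_class A t \<equiv> restr_cong_gen (rterm_algebra A) {} `` {t}"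

lemma FR_simps:
  "set_rterm s \<subseteq> A \<Longrightarrow> set_rterm t \<subseteq> A \<Longrightarrow> FR_class A s \<otimes>\<^bsub>FR A\<^esub> FR_class A t = FR_class A (RMult s t)"
  "\<one>\<^bsub>FR A\<^esub> = FR_class A ROne"
  "set_rterm t \<subseteq> A \<Longrightarrow> (FR_class A t)\<^sup>\<star>\<^bsub>FR A\<^esub> = FR_class A (RStar t)"
  "set_rterm t \<subseteq> A \<Longrightarrow> (FR_class A t)\<^sup>\<oplus>\<^bsub>FR A\<^esub> = FR_class A (RPlus t)"
  "carrier (FR A) = FR_class A ` {t. set_rterm t \<subseteq> A}"
  using restr_quot_simps[OF FR_cong_props(1)[of A]]
  by (auto simp: FR_def rterm_algebra_def)

lemma FR_gen_closed: "a \<in> A \<Longrightarrow> FR_gen A a \<in> carrier (FR A)"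
  by (auto simp: FR_gen_def FR_simps)

context
  fixes S :: "('s, 'd) restr_monoid_scheme" and A :: "'a set" and g :: "'a \<Rightarrow> 's"
  assumes S: "restriction_monoid S" and g: "g \<in> A \<rightarrow> carrier S"
begin

lemma rterm_eval_closed: "set_rterm t \<subseteq> A \<Longrightarrow> rterm_eval S g t \<in> carrier S"
proof -
  interpret S: restriction_monoid S by (rule S)
  show "set_rterm t \<subseteq> A \<Longrightarrow> rterm_eval S g t \<in> carrier S"
    using g by (induction t) (auto intro: S.star_closed S.plus_closed)
qed

lemma rterm_eval_cong:
  assumes "(s, t) \<in> restr_cong_gen (rterm_algebra A) {}"
  shows "rterm_eval S g s = rterm_eval S g t"
proof -
  interpret S: restriction_monoid S by (rule S)
  define \<kappa> where "\<kappa> = {(s, t). set_rterm s \<subseteq> A \<and> set_rterm t \<subseteq> A \<and> rterm_eval S g s = rterm_eval S g t}"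
  have c: "restr_congruence (rterm_algebra A) \<kappa>"
    unfolding restr_congruence_def \<kappa>_def
    by (auto simp: rterm_algebra_def equiv_def refl_on_def sym_def trans_def)
  have "restr_ax_pairs (rterm_algebra A) \<subseteq> \<kappa>"
    unfolding restr_ax_pairs_def \<kappa>_def Let_def
    by (auto simp: rterm_algebra_def rterm_eval_closed S.m_assoc S.plus_left S.star_right
        S.star_of_plus S.plus_of_star S.star_star S.plus_plus S.star_closed S.plus_closed
        intro!: S.plus_comm S.star_comm S.plus_ample S.star_ample)
  then have "restriction_monoid (restr_quot (rterm_algebra A) \<kappa>)"
    using restriction_monoid_quot_iff[OF c restr_closed_rterm_algebra] by blast
  with c have "restr_cong_gen (rterm_algebra A) {} \<subseteq> \<kappa>"
    unfolding restr_cong_gen_def by blast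
  with assms show ?thesis by (auto simp: \<kappa>_def)
qed

lemma FR_hom_unique:
  assumes h: "h \<in> restr_hom (FR A) S" and gen: "\<And>a. a \<in> A \<Longrightarrow> h (FR_gen A a) = g a"
    and t: "set_rterm t \<subseteq> A"
  shows "h (FR_class A t) = rterm_eval S g t"
  using t
proof (induction t)
  case (RGen a)
  then show ?case using gen[of a] by (simp add: FR_gen_def)
next
  case ROne
  then show ?case using h by (simp add: restr_hom_def FR_simps(2))
next
  case (RMult s t)
  then have "h (FR_class A s \<otimes>\<^bsub>FR A\<^esub> FR_class A t) = h (FR_class A s) \<otimes>\<^bsub>S\<^esub> h (FR_class A t)"
    using h by (auto simp: restr_hom_def hom_def FR_simps(5))
  with RMult show ?case by (simp add: FR_simps)
next
  case (RStar t)
  then have "h ((FR_class A t)\<^sup>\<star>\<^bsub>FR A\<^esub>) = (h (FR_class A t))\<^sup>\<star>\<^bsub>S\<^esub>"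
    using h by (auto simp: restr_hom_def FR_simps(5))
  with RStar show ?case by (simp add: FR_simps)
next
  case (RPlus t)
  then have "h ((FR_class A t)\<^sup>\<oplus>\<^bsub>FR A\<^esub>) = (h (FR_class A t))\<^sup>\<oplus>\<^bsub>S\<^esub>"
    using h by (auto simp: restr_hom_def FR_simps(5))
  with RPlus show ?case by (simp add: FR_simps)
qed

lemma FR_hom_exists:
  "\<exists>h \<in> restr_hom (FR A) S. (\<forall>a\<in>A. h (FR_gen A a) = g a) \<and>
     (\<forall>t. set_rterm t \<subseteq> A \<longrightarrow> h (FR_class A t) = rterm_eval S g t)"
proof -
  interpret S: restriction_monoid S by (rule S)
  define h where "h p = rterm_eval S g (SOME t. t \<in> p)" for p
  have eq: "equiv {t. set_rterm t \<subseteq> A} (restr_cong_gen (rterm_algebra A) {})"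
    using FR_cong_props(1)[of A] by (simp add: restr_congruence_def rterm_algebra_def)
  have ev: "h (FR_class A t) = rterm_eval S g t" if t: "set_rterm t \<subseteq> A" for t
  proof -
    have "t \<in> FR_class A t" using equiv_class_self[OF eq] t by simp
    then have "(SOME s. s \<in> FR_class A t) \<in> FR_class A t" by (rule someI)
    then show ?thesis unfolding h_def using rterm_eval_cong by force
  qed
  have "h \<in> restr_hom (FR A) S"
    unfolding restr_hom_def hom_def
    by (auto simp: FR_simps ev rterm_eval_closed)
  moreover have "\<forall>a\<in>A. h (FR_gen A a) = g a" by (simp add: FR_gen_def ev)
  ultimately show ?thesis using ev by blast
qed

lemma FR_value_eq:
  assumes t: "set_rterm t \<subseteq> A"
  shows "FR_value A S g (FR_class A t) = rterm_eval S g t"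
  unfolding FR_value_def
  by (rule the_equality) (use FR_hom_exists FR_hom_unique t in blast)+

end

lemma word_ext_closed:
  assumes "monoid M" and "f \<in> X \<rightarrow> carrier M" and "w \<in> lists X"
  shows "word_ext M f w \<in> carrier M"
  using assms(3)
proof (induction w)
  case Nil
  then show ?case using assms by (simp add: word_ext_def monoid.one_closed)
next
  case (Cons x w)
  then show ?case using assms by (auto simp: word_ext_def intro!: monoid.m_closed)
qed

text \<open>Every monoid and every restriction monoid, over any types, are covered by \<open>admissible\<close>.\<close>

lemma admissible_satisfies:
  fixes X :: "'x set" and M :: "('m, 'c) monoid_scheme" and S :: "('s, 'd) restr_monoid_scheme"
  assumes adm: "admissible X pq" and pq: "pq \<in> identities X"
    and M: "monoid M" and S: "restriction_monoid S"
    and \<gamma>: "\<gamma> \<in> hom M S" "\<gamma> \<one>\<^bsub>M\<^esub> = \<one>\<^bsub>S\<^esub>"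
  shows "satisfies X M S \<gamma> pq"
proof -
  interpret S: restriction_monoid S by (rule S)
  interpret F: restriction_monoid "FR X" by (rule restriction_monoid_FR)
  obtain s t where pq_eq: "pq = (FR_class (lists X) s, FR_class (lists X) t)"
    and s: "set_rterm s \<subseteq> lists X" and t: "set_rterm t \<subseteq> lists X"
    using pq by (auto simp: identities_def FR_simps)
  define W :: "'x list monoid" where "W = \<lparr>carrier = lists X, mult = (@), one = []\<rparr>"
  define \<delta> where "\<delta> w = foldr (\<lambda>x m. FR_gen X x \<otimes>\<^bsub>FR X\<^esub> m) w \<one>\<^bsub>FR X\<^esub>" for w
  have W: "monoid W" by unfold_locales (auto simp: W_def)
  have \<delta>_closed: "\<delta> w \<in> carrier (FR X)" if "w \<in> lists X" for w
    using that by (induction w) (auto simp: \<delta>_def FR_gen_closed)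
  have \<delta>_append: "\<delta> (v @ w) = \<delta> v \<otimes>\<^bsub>FR X\<^esub> \<delta> w" if "v \<in> lists X" "w \<in> lists X" for v w
    using that(1)
  proof (induction v)
    case Nil
    then show ?case using \<delta>_closed[OF that(2)] by (simp add: \<delta>_def)
  next
    case (Cons x v)
    then show ?case
      using \<delta>_closed[OF that(2)] \<delta>_closed[of v] FR_gen_closed[of x X]
      by (auto simp: \<delta>_def F.m_assoc)
  qed
  have "\<delta> \<in> hom W (FR X)" "\<delta> \<one>\<^bsub>W\<^esub> = \<one>\<^bsub>FR X\<^esub>"
    using \<delta>_closed \<delta>_append by (simp_all add: hom_def W_def Pi_def) (simp add: \<delta>_def)
  then have "satisfies X W (FR X) \<delta> pq"
    using adm W restriction_monoid_FR unfolding admissible_def by blast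
  moreover have "(\<lambda>x. [x]) \<in> X \<rightarrow> carrier W" by (auto simp: W_def)
  ultimately have "id_value X W (FR X) \<delta> (\<lambda>x. [x]) (FR_class (lists X) s) =
      id_value X W (FR X) \<delta> (\<lambda>x. [x]) (FR_class (lists X) t)"
    by (auto simp: satisfies_def pq_eq)
  moreover have "word_ext W (\<lambda>x. [x]) = (\<lambda>w. w)"
  proof
    show "word_ext W (\<lambda>x. [x]) w = w" for w by (induction w) (auto simp: word_ext_def W_def)
  qed
  moreover have "\<delta> \<in> lists X \<rightarrow> carrier (FR X)" using \<delta>_closed by blast
  ultimately have free: "rterm_eval (FR X) \<delta> s = rterm_eval (FR X) \<delta> t"
    using s t by (simp add: id_value_def FR_value_eq[OF restriction_monoid_FR])
  have "id_value X M S \<gamma> f (FR_class (lists X) s) = id_value X M S \<gamma> f (FR_class (lists X) t)"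
    if f: "f \<in> X \<rightarrow> carrier M" for f
  proof -
    have g: "(\<lambda>w. \<gamma> (word_ext M f w)) \<in> lists X \<rightarrow> carrier S"
      using word_ext_closed[OF M f] \<gamma> by (auto simp: hom_def)
    have "(\<lambda>x. \<gamma> (f x)) \<in> X \<rightarrow> carrier S" using f \<gamma> by (auto simp: hom_def)
    from FR_hom_exists[OF S this] obtain h where h: "h \<in> restr_hom (FR X) S"
      and hg: "\<And>x. x \<in> X \<Longrightarrow> h (FR_gen X x) = \<gamma> (f x)" by blast
    have h\<delta>: "h (\<delta> w) = \<gamma> (word_ext M f w)" if "w \<in> lists X" for w
      using that
    proof (induction w)
      case Nil
      then show ?case using h \<gamma> by (simp add: \<delta>_def word_ext_def restr_hom_def)
    next
      case (Cons x w)
      have "h (FR_gen X x \<otimes>\<^bsub>FR X\<^esub> \<delta> w) = h (FR_gen X x) \<otimes>\<^bsub>S\<^esub> h (\<delta> w)"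
        using h Cons FR_gen_closed[of x X] \<delta>_closed[of w] by (auto simp: restr_hom_def hom_def)
      moreover have "\<gamma> (f x \<otimes>\<^bsub>M\<^esub> word_ext M f w) = \<gamma> (f x) \<otimes>\<^bsub>S\<^esub> \<gamma> (word_ext M f w)"
        using \<gamma> f Cons word_ext_closed[OF M f, of w] by (auto simp: hom_def)
      ultimately show ?case using Cons hg[of x] by (simp add: \<delta>_def word_ext_def)
    qed
    have *: "h (rterm_eval (FR X) \<delta> u) = rterm_eval S (\<lambda>w. \<gamma> (word_ext M f w)) u"
      if "set_rterm u \<subseteq> lists X" for u
      using that
    proof (induction u)
      case (RGen a)
      then show ?case using h\<delta> by simp
    next
      case ROne
      then show ?case using h by (simp add: restr_hom_def)
    next
      case (RMult u v)
      then show ?case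
        using h rterm_eval_closed[OF restriction_monoid_FR \<open>\<delta> \<in> lists X \<rightarrow> carrier (FR X)\<close>, of u]
          rterm_eval_closed[OF restriction_monoid_FR \<open>\<delta> \<in> lists X \<rightarrow> carrier (FR X)\<close>, of v]
        by (auto simp: restr_hom_def hom_def)
    next
      case (RStar u)
      then show ?case
        using h rterm_eval_closed[OF restriction_monoid_FR \<open>\<delta> \<in> lists X \<rightarrow> carrier (FR X)\<close>, of u]
        by (auto simp: restr_hom_def)
    next
      case (RPlus u)
      then show ?case
        using h rterm_eval_closed[OF restriction_monoid_FR \<open>\<delta> \<in> lists X \<rightarrow> carrier (FR X)\<close>, of u]
        by (auto simp: restr_hom_def)
    qed
    have "rterm_eval S (\<lambda>w. \<gamma> (word_ext M f w)) s = rterm_eval S (\<lambda>w. \<gamma> (word_ext M f w)) t"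
      using *[OF s] *[OF t] free by simp
    then show ?thesis using s t by (simp add: id_value_def FR_value_eq[OF S g])
  qed
  then show ?thesis by (simp add: satisfies_def pq_eq)
qed

end

theory Submission
  imports Defs
begin

text \<open>
  The universal property gives a morphism from \<open>FRR X R M\<close> to \<open>FIR X R M\<close> taking generators to
  generators. Every element \<open>a\<close> of \<open>FRR X R M\<close> is \<open>a\<^sup>\<oplus>\<close> times a generator \<open>\<lfloor>m\<rfloor>\<close>, so for injectivity
  it suffices to recover \<open>m\<close> and \<open>a\<^sup>\<oplus>\<close> from the image. The embedding of \<open>M\<close> into a group \<open>G\<close> satisfies
  all admissible identities, hence extends to \<open>FIR X R M\<close> and detects \<open>m\<close>. The Munn representation of
  \<open>FRR X R M\<close> by partial bijections of its projections is injective on projections, and since it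
  takes values in an inverse monoid it factors through \<open>FIR X R M\<close>, so it detects \<open>a\<^sup>\<oplus>\<close>.
  For the image, the idempotents of \<open>FIR X R M\<close> lie in every restriction submonoid \<open>H\<close> containing the
  generators, since the elements that conjugate idempotents of \<open>H\<close> into \<open>H\<close> form an inverse
  submonoid.
\<close>

section \<open>Restriction monoids\<close>

text \<open>The two mixed axioms make this the common range of \<open>rplus\<close> and
  \<open>rstar\<close>. In general it can be smaller than the set of idempotents; for the reduct of
  an inverse monoid the two sets agree (\<open>projections_restr_of_inv\<close>). Below, e \<le> f
  for projections means \<open>e \<otimes> f = e\<close>.\<close>

definition projections :: "('a, 'c) restr_monoid_scheme \<Rightarrow> 'a set" where
  "projections S = {e \<in> carrier S. e\<^sup>\<oplus>\<^bsub>S\<^esub> = e}"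

context restriction_monoid
begin

lemma projections_closed: "e \<in> projections S \<Longrightarrow> e \<in> carrier S"
  by (simp add: projections_def)

lemma projections_plus: "e \<in> projections S \<Longrightarrow> e\<^sup>\<oplus> = e"
  by (simp add: projections_def)

lemma projections_star: "e \<in> projections S \<Longrightarrow> e\<^sup>\<star> = e"
  using star_of_plus by (fastforce simp: projections_def)

lemma plus_projection: "x \<in> carrier S \<Longrightarrow> x\<^sup>\<oplus> \<in> projections S"
  using plus_of_star[of "x\<^sup>\<oplus>"] by (simp add: projections_def star_of_plus plus_closed)

lemma star_projection: "x \<in> carrier S \<Longrightarrow> x\<^sup>\<star> \<in> projections S"
  by (simp add: projections_def plus_of_star star_closed)

lemma projections_comm:
  "e \<in> projections S \<Longrightarrow> f \<in> projections S \<Longrightarrow> e \<otimes> f = f \<otimes> e"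
  by (metis plus_comm projections_closed projections_plus)

lemma projections_idem: "e \<in> projections S \<Longrightarrow> e \<otimes> e = e"
  by (metis plus_left projections_closed projections_plus)

lemma plus_projection_left:
  "e \<in> projections S \<Longrightarrow> x \<in> carrier S \<Longrightarrow> (e \<otimes> x)\<^sup>\<oplus> = e \<otimes> x\<^sup>\<oplus>"
  by (metis plus_plus projections_closed projections_plus)

lemma star_projection_right:
  "e \<in> projections S \<Longrightarrow> x \<in> carrier S \<Longrightarrow> (x \<otimes> e)\<^sup>\<star> = x\<^sup>\<star> \<otimes> e"
  by (metis star_star projections_closed projections_star)

lemma projections_mult:
  "e \<in> projections S \<Longrightarrow> f \<in> projections S \<Longrightarrow> e \<otimes> f \<in> projections S"
  using plus_projection_left[of e f] by (simp add: projections_def)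

lemma one_projection: "\<one> \<in> projections S"
  using plus_left[of \<one>] by (simp add: projections_def plus_closed)

lemma mult_projection:
  "e \<in> projections S \<Longrightarrow> x \<in> carrier S \<Longrightarrow> x \<otimes> e = (x \<otimes> e)\<^sup>\<oplus> \<otimes> x"
  by (metis plus_ample projections_closed projections_plus)

lemma projection_mult:
  "e \<in> projections S \<Longrightarrow> x \<in> carrier S \<Longrightarrow> e \<otimes> x = x \<otimes> (e \<otimes> x)\<^sup>\<star>"
  by (metis star_ample projections_closed projections_star)

text \<open>As \<open>x\<^sup>\<oplus>\<close> fixes \<open>x \<otimes> y\<close> on the left, the
  axiom \<open>plus_plus\<close> pulls it out of
  \<open>(x\<^sup>\<oplus> \<otimes> (x \<otimes> y))\<^sup>\<oplus>\<close>. In the order of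
  projections this reads
  \<open>(x \<otimes> y)\<^sup>\<oplus> \<le> x\<^sup>\<oplus>\<close>.\<close>

lemma plus_mult_absorb:
  assumes "x \<in> carrier S" "y \<in> carrier S"
  shows "(x \<otimes> y)\<^sup>\<oplus> \<otimes> x\<^sup>\<oplus> = (x \<otimes> y)\<^sup>\<oplus>"
  using assms plus_comm[of "x \<otimes> y" x] plus_plus[of x "x \<otimes> y"] plus_left[of x]
  by (simp add: m_assoc[symmetric] plus_closed)

lemma star_mult_absorb:
  assumes "x \<in> carrier S" "y \<in> carrier S"
  shows "(x \<otimes> y)\<^sup>\<star> \<otimes> y\<^sup>\<star> = (x \<otimes> y)\<^sup>\<star>"
  using assms star_star[of "x \<otimes> y" y] star_right[of y] by (simp add: m_assoc star_closed)

text \<open>The ample identity turns \<open>x \<otimes> y\<^sup>\<oplus>\<close> into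
  \<open>(x \<otimes> y)\<^sup>\<oplus> \<otimes> x\<close>, and the resulting factor
  \<open>x\<^sup>\<oplus>\<close> is absorbed. \<open>star_star_mult\<close> is the dual.\<close>

lemma plus_mult_plus:
  assumes "x \<in> carrier S" "y \<in> carrier S"
  shows "(x \<otimes> y\<^sup>\<oplus>)\<^sup>\<oplus> = (x \<otimes> y)\<^sup>\<oplus>"
  using assms plus_ample[of x y] plus_plus[of "x \<otimes> y" x] plus_mult_absorb by simp

lemma star_star_mult:
  assumes "x \<in> carrier S" "y \<in> carrier S"
  shows "(x\<^sup>\<star> \<otimes> y)\<^sup>\<star> = (x \<otimes> y)\<^sup>\<star>"
  using assms star_ample[of x y] star_star[of y "x \<otimes> y"] star_mult_absorb star_comm[of y "x \<otimes> y"]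
  by simp

end

section \<open>Morphisms of restriction monoids\<close>

lemma restr_homD:
  assumes "h \<in> restr_hom S T"
  shows "x \<in> carrier S \<Longrightarrow> h x \<in> carrier T"
    and "x \<in> carrier S \<Longrightarrow> y \<in> carrier S \<Longrightarrow> h (x \<otimes>\<^bsub>S\<^esub> y) = h x \<otimes>\<^bsub>T\<^esub> h y"
    and "h \<one>\<^bsub>S\<^esub> = \<one>\<^bsub>T\<^esub>"
    and "x \<in> carrier S \<Longrightarrow> h (x\<^sup>\<star>\<^bsub>S\<^esub>) = (h x)\<^sup>\<star>\<^bsub>T\<^esub>"
    and "x \<in> carrier S \<Longrightarrow> h (x\<^sup>\<oplus>\<^bsub>S\<^esub>) = (h x)\<^sup>\<oplus>\<^bsub>T\<^esub>"
  using assms by (auto simp: restr_hom_def hom_def)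

lemma restr_hom_image:
  assumes S: "restriction_monoid S" and h: "h \<in> restr_hom S T"
  shows "restriction_submonoid (h ` carrier S) T"
proof -
  interpret S: restriction_monoid S by (rule S)
  note hD = restr_homD[OF h]
  show ?thesis
  proof
    show "h ` carrier S \<subseteq> carrier T" using hD(1) by blast
    show "\<one>\<^bsub>T\<^esub> \<in> h ` carrier S" using hD(3) by (metis S.one_closed imageI)
    show "x \<otimes>\<^bsub>T\<^esub> y \<in> h ` carrier S" if "x \<in> h ` carrier S" "y \<in> h ` carrier S" for x y
      using that hD(2) by (auto simp flip: hD(2))
    show "x\<^sup>\<star>\<^bsub>T\<^esub> \<in> h ` carrier S" if "x \<in> h ` carrier S" for x
      using that by (auto simp: S.star_closed simp flip: hD(4))
    show "x\<^sup>\<oplus>\<^bsub>T\<^esub> \<in> h ` carrier S" if "x \<in> h ` carrier S" for x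
      using that by (auto simp: S.plus_closed simp flip: hD(5))
  qed
qed

section \<open>Inverse monoids\<close>

context inverse_monoid
begin

lemma idempotentsD:
  assumes "e \<in> idempotents S"
  shows "e \<in> carrier S" and "e \<otimes> e = e" and "e\<^sup>\<dagger> = e"
  using assms ginv_unique[of e e] by (auto simp: idempotents_def)

lemma ginv_ginv: "x \<in> carrier S \<Longrightarrow> (x\<^sup>\<dagger>)\<^sup>\<dagger> = x"
  using ginv_unique[of "x\<^sup>\<dagger>" x] by (simp add: ginv_closed ginv_regular ginv_regular')

lemma mult_ginv_idempotent: "x \<in> carrier S \<Longrightarrow> x \<otimes> x\<^sup>\<dagger> \<in> idempotents S"
  using ginv_regular[of x] by (simp add: idempotents_def ginv_closed m_assoc[symmetric])

lemma ginv_mult_idempotent: "x \<in> carrier S \<Longrightarrow> x\<^sup>\<dagger> \<otimes> x \<in> idempotents S"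
  using ginv_regular'[of x] by (simp add: idempotents_def ginv_closed m_assoc[symmetric])

text \<open>Let x be the inverse of \<open>e \<otimes> f\<close>. Then
  \<open>f \<otimes> x \<otimes> e\<close> is an inverse of \<open>e \<otimes> f\<close> too, so it
  equals x, and this makes x idempotent. An idempotent is its own inverse, so
  \<open>e \<otimes> f\<close>, being the inverse of x, is x.\<close>

lemma idempotents_mult:
  assumes e: "e \<in> idempotents S" and f: "f \<in> idempotents S"
  shows "e \<otimes> f \<in> idempotents S"
proof -
  note [simp] = idempotentsD(1)[OF e] idempotentsD(1)[OF f]
  define x where "x = (e \<otimes> f)\<^sup>\<dagger>"
  have [simp]: "x \<in> carrier S" by (simp add: x_def ginv_closed)
  have ee: "e \<otimes> (e \<otimes> z) = e \<otimes> z" "f \<otimes> (f \<otimes> z) = f \<otimes> z" if "z \<in> carrier S" for z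
    using that idempotentsD(2)[OF e] idempotentsD(2)[OF f] by (simp_all add: m_assoc[symmetric])
  have r: "e \<otimes> (f \<otimes> (x \<otimes> (e \<otimes> f))) = e \<otimes> f" and r': "x \<otimes> (e \<otimes> (f \<otimes> x)) = x"
    using ginv_regular[of "e \<otimes> f"] ginv_regular'[of "e \<otimes> f"] by (simp_all add: x_def[symmetric] m_assoc)
  have r'': "x \<otimes> (e \<otimes> (f \<otimes> (x \<otimes> z))) = x \<otimes> z" if "z \<in> carrier S" for z
    using that arg_cong[OF r', of "\<lambda>u. u \<otimes> z"] by (simp add: m_assoc)
  have "f \<otimes> x \<otimes> e = x"
    using ginv_unique[of "e \<otimes> f" "f \<otimes> x \<otimes> e"] by (simp add: m_assoc ee r r'' x_def[symmetric])
  then have "x \<otimes> x = x" using r' by (metis (no_types, lifting) \<open>x \<in> carrier S\<close> e f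
      idempotentsD(1) m_assoc m_closed)
  then have "x \<in> idempotents S" by (simp add: idempotents_def)
  moreover have "e \<otimes> f = x\<^sup>\<dagger>" by (simp add: x_def ginv_ginv)
  ultimately show ?thesis using idempotentsD(3) by metis
qed

text \<open>Both products are idempotent, so \<open>f \<otimes> e\<close> is an inverse of
  \<open>e \<otimes> f\<close>; but the idempotent \<open>e \<otimes> f\<close> is its own
  inverse.\<close>

lemma idempotents_comm:
  assumes e: "e \<in> idempotents S" and f: "f \<in> idempotents S"
  shows "e \<otimes> f = f \<otimes> e"
proof -
  note [simp] = idempotentsD(1)[OF e] idempotentsD(1)[OF f]
  have ee: "e \<otimes> (e \<otimes> z) = e \<otimes> z" "f \<otimes> (f \<otimes> z) = f \<otimes> z" if "z \<in> carrier S" for z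
    using that idempotentsD(2)[OF e] idempotentsD(2)[OF f] by (simp_all add: m_assoc[symmetric])
  have "e \<otimes> f \<in> idempotents S" "f \<otimes> e \<in> idempotents S" using e f by (simp_all add: idempotents_mult)
  then have "f \<otimes> e = (e \<otimes> f)\<^sup>\<dagger>"
    using ginv_unique[of "e \<otimes> f" "f \<otimes> e"] by (auto simp: idempotents_def m_assoc ee)
  then show ?thesis using \<open>e \<otimes> f \<in> idempotents S\<close> idempotentsD(3) by metis
qed

text \<open>By uniqueness it suffices that
  \<open>y\<^sup>\<dagger> \<otimes> x\<^sup>\<dagger>\<close> is an inverse of
  \<open>x \<otimes> y\<close>, which follows by commuting the idempotents
  \<open>y \<otimes> y\<^sup>\<dagger>\<close> and
  \<open>x\<^sup>\<dagger> \<otimes> x\<close>.\<close>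

lemma ginv_mult:
  assumes [simp]: "x \<in> carrier S" "y \<in> carrier S"
  shows "(x \<otimes> y)\<^sup>\<dagger> = y\<^sup>\<dagger> \<otimes> x\<^sup>\<dagger>"
proof -
  note [simp] = ginv_closed
  \<comment> \<open>The trailing factor z lets the commutation act as a rewrite rule inside products
    bracketed to the right.\<close>
  have c: "y \<otimes> (y\<^sup>\<dagger> \<otimes> (x\<^sup>\<dagger> \<otimes> (x \<otimes> z))) = x\<^sup>\<dagger> \<otimes> (x \<otimes> (y \<otimes> (y\<^sup>\<dagger> \<otimes> z)))" if "z \<in> carrier S" for z
    using that arg_cong[OF idempotents_comm[OF mult_ginv_idempotent[of y] ginv_mult_idempotent[of x]],
        of "\<lambda>u. u \<otimes> z"] by (simp add: m_assoc)
  have c': "y \<otimes> (y\<^sup>\<dagger> \<otimes> y) = y" "x\<^sup>\<dagger> \<otimes> (x \<otimes> x\<^sup>\<dagger>) = x\<^sup>\<dagger>"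
    using ginv_regular[of y] ginv_regular'[of x] by (simp_all add: m_assoc)
  have c'': "x \<otimes> (x\<^sup>\<dagger> \<otimes> (x \<otimes> z)) = x \<otimes> z" "y\<^sup>\<dagger> \<otimes> (y \<otimes> (y\<^sup>\<dagger> \<otimes> z)) = y\<^sup>\<dagger> \<otimes> z" if "z \<in> carrier S" for z
    using that arg_cong[OF ginv_regular[of x], of "\<lambda>u. u \<otimes> z"]
      arg_cong[OF ginv_regular'[of y], of "\<lambda>u. u \<otimes> z"] by (simp_all add: m_assoc)
  have "x \<otimes> y \<otimes> (y\<^sup>\<dagger> \<otimes> x\<^sup>\<dagger>) \<otimes> (x \<otimes> y) = x \<otimes> y"
    by (simp add: m_assoc c c' c'')
  moreover have "y\<^sup>\<dagger> \<otimes> x\<^sup>\<dagger> \<otimes> (x \<otimes> y) \<otimes> (y\<^sup>\<dagger> \<otimes> x\<^sup>\<dagger>) = y\<^sup>\<dagger> \<otimes> x\<^sup>\<dagger>"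
    by (simp add: m_assoc c[symmetric] c' c'')
  ultimately show ?thesis using ginv_unique[of "x \<otimes> y" "y\<^sup>\<dagger> \<otimes> x\<^sup>\<dagger>"] by simp
qed

lemma ginv_one: "\<one>\<^sup>\<dagger> = \<one>"
  using ginv_unique[of \<one> \<one>] by simp

lemma restr_of_inv_simps:
  "carrier (restr_of_inv S) = carrier S" "x \<otimes>\<^bsub>restr_of_inv S\<^esub> y = x \<otimes> y"
  "\<one>\<^bsub>restr_of_inv S\<^esub> = \<one>" "x\<^sup>\<star>\<^bsub>restr_of_inv S\<^esub> = x\<^sup>\<dagger> \<otimes> x" "x\<^sup>\<oplus>\<^bsub>restr_of_inv S\<^esub> = x \<otimes> x\<^sup>\<dagger>"
  by (simp_all add: restr_of_inv_def)

text \<open>Conjugation is thereby expressed by the restriction operations alone, so a restriction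
  submonoid containing x and e also contains both conjugates of e by x.\<close>

lemma conj_idempotent:
  assumes x: "x \<in> carrier S" and e: "e \<in> idempotents S"
  shows "x \<otimes> e \<otimes> x\<^sup>\<dagger> = (x \<otimes> e)\<^sup>\<oplus>\<^bsub>restr_of_inv S\<^esub>"
    and "x\<^sup>\<dagger> \<otimes> e \<otimes> x = (e \<otimes> x)\<^sup>\<star>\<^bsub>restr_of_inv S\<^esub>"
    and "x \<otimes> e \<otimes> x\<^sup>\<dagger> \<in> idempotents S"
    and "x\<^sup>\<dagger> \<otimes> e \<otimes> x \<in> idempotents S"
proof -
  note [simp] = x idempotentsD(1,3)[OF e] ginv_closed
  have ee: "e \<otimes> (e \<otimes> z) = e \<otimes> z" if "z \<in> carrier S" for z
    using that idempotentsD(2)[OF e] by (simp add: m_assoc[symmetric])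
  show 1: "x \<otimes> e \<otimes> x\<^sup>\<dagger> = (x \<otimes> e)\<^sup>\<oplus>\<^bsub>restr_of_inv S\<^esub>"
    by (simp add: restr_of_inv_simps ginv_mult m_assoc ee)
  show 2: "x\<^sup>\<dagger> \<otimes> e \<otimes> x = (e \<otimes> x)\<^sup>\<star>\<^bsub>restr_of_inv S\<^esub>"
    by (simp add: restr_of_inv_simps ginv_mult m_assoc ee)
  show "x \<otimes> e \<otimes> x\<^sup>\<dagger> \<in> idempotents S"
    unfolding 1 by (simp add: restr_of_inv_simps mult_ginv_idempotent)
  show "x\<^sup>\<dagger> \<otimes> e \<otimes> x \<in> idempotents S"
    unfolding 2 by (simp add: restr_of_inv_simps ginv_mult_idempotent)
qed

text \<open>The idempotent e commutes with \<open>x\<^sup>\<dagger> \<otimes> x\<close> and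
  \<open>x \<otimes> x\<^sup>\<dagger>\<close>, which are then absorbed by x. For e of the form
  \<open>y \<otimes> y\<^sup>\<dagger>\<close> or \<open>y\<^sup>\<dagger> \<otimes> y\<close> these
  become the ample identities of the reduct.\<close>

lemma idempotent_commute_conj:
  assumes "x \<in> carrier S" "e \<in> idempotents S"
  shows "x \<otimes> e = x \<otimes> e \<otimes> x\<^sup>\<dagger> \<otimes> x" and "e \<otimes> x = x \<otimes> (x\<^sup>\<dagger> \<otimes> e \<otimes> x)"
proof -
  note [simp] = assms(1) idempotentsD(1)[OF assms(2)] ginv_closed
  have "x \<otimes> e \<otimes> x\<^sup>\<dagger> \<otimes> x = x \<otimes> (e \<otimes> (x\<^sup>\<dagger> \<otimes> x))" by (simp add: m_assoc)
  also have "\<dots> = x \<otimes> ((x\<^sup>\<dagger> \<otimes> x) \<otimes> e)"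
    using idempotents_comm[OF assms(2) ginv_mult_idempotent[of x]] by simp
  also have "\<dots> = x \<otimes> e" using ginv_regular[of x] by (simp add: m_assoc[symmetric])
  finally show "x \<otimes> e = x \<otimes> e \<otimes> x\<^sup>\<dagger> \<otimes> x" by simp
  have "x \<otimes> (x\<^sup>\<dagger> \<otimes> e \<otimes> x) = ((x \<otimes> x\<^sup>\<dagger>) \<otimes> e) \<otimes> x" by (simp add: m_assoc)
  also have "\<dots> = (e \<otimes> (x \<otimes> x\<^sup>\<dagger>)) \<otimes> x"
    using idempotents_comm[OF assms(2) mult_ginv_idempotent[of x]] by simp
  also have "\<dots> = e \<otimes> x" using ginv_regular[of x] by (simp add: m_assoc)
  finally show "e \<otimes> x = x \<otimes> (x\<^sup>\<dagger> \<otimes> e \<otimes> x)" by simp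
qed

lemma restriction_monoid_restr_of_inv: "restriction_monoid (restr_of_inv S)"
proof -
  note [simp] = restr_of_inv_simps ginv_closed
  have id: "(e \<otimes> e\<^sup>\<dagger>) = e" "e\<^sup>\<dagger> \<otimes> e = e" if "e \<in> idempotents S" for e
    using idempotentsD[OF that] by simp_all
  note idem = mult_ginv_idempotent ginv_mult_idempotent
  have "monoid (restr_of_inv S)" by (rule monoidI) (auto simp: m_assoc)
  moreover have "restriction_monoid_axioms (restr_of_inv S)"
  proof
    fix x y assume "x \<in> carrier (restr_of_inv S)" "y \<in> carrier (restr_of_inv S)"
    then have x[simp]: "x \<in> carrier S" and y[simp]: "y \<in> carrier S" by simp_all
    let ?S = "restr_of_inv S"
    show "x\<^sup>\<star>\<^bsub>?S\<^esub> \<in> carrier ?S" "x\<^sup>\<oplus>\<^bsub>?S\<^esub> \<in> carrier ?S" by simp_all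
    show "x\<^sup>\<oplus>\<^bsub>?S\<^esub> \<otimes>\<^bsub>?S\<^esub> x = x" "x \<otimes>\<^bsub>?S\<^esub> x\<^sup>\<star>\<^bsub>?S\<^esub> = x"
      using ginv_regular[of x] by (simp_all add: m_assoc)
    show "x\<^sup>\<oplus>\<^bsub>?S\<^esub> \<otimes>\<^bsub>?S\<^esub> y\<^sup>\<oplus>\<^bsub>?S\<^esub> = y\<^sup>\<oplus>\<^bsub>?S\<^esub> \<otimes>\<^bsub>?S\<^esub> x\<^sup>\<oplus>\<^bsub>?S\<^esub>" "x\<^sup>\<star>\<^bsub>?S\<^esub> \<otimes>\<^bsub>?S\<^esub> y\<^sup>\<star>\<^bsub>?S\<^esub> = y\<^sup>\<star>\<^bsub>?S\<^esub> \<otimes>\<^bsub>?S\<^esub> x\<^sup>\<star>\<^bsub>?S\<^esub>"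
      by (simp_all add: idempotents_comm idem)
    show "(x\<^sup>\<oplus>\<^bsub>?S\<^esub>)\<^sup>\<star>\<^bsub>?S\<^esub> = x\<^sup>\<oplus>\<^bsub>?S\<^esub>" "(x\<^sup>\<star>\<^bsub>?S\<^esub>)\<^sup>\<oplus>\<^bsub>?S\<^esub> = x\<^sup>\<star>\<^bsub>?S\<^esub>"
      by (simp_all add: id idem)
    have "x \<otimes> (y \<otimes> y\<^sup>\<dagger>) = x \<otimes> (y \<otimes> y\<^sup>\<dagger>) \<otimes> x\<^sup>\<dagger> \<otimes> x" by (rule idempotent_commute_conj) (simp_all add: idem)
    then show "x \<otimes>\<^bsub>?S\<^esub> y\<^sup>\<oplus>\<^bsub>?S\<^esub> = (x \<otimes>\<^bsub>?S\<^esub> y)\<^sup>\<oplus>\<^bsub>?S\<^esub> \<otimes>\<^bsub>?S\<^esub> x"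
      by (simp add: ginv_mult m_assoc)
    have "(x\<^sup>\<dagger> \<otimes> x) \<otimes> y = y \<otimes> (y\<^sup>\<dagger> \<otimes> (x\<^sup>\<dagger> \<otimes> x) \<otimes> y)" by (rule idempotent_commute_conj) (simp_all add: idem)
    then show "x\<^sup>\<star>\<^bsub>?S\<^esub> \<otimes>\<^bsub>?S\<^esub> y = y \<otimes>\<^bsub>?S\<^esub> (x \<otimes>\<^bsub>?S\<^esub> y)\<^sup>\<star>\<^bsub>?S\<^esub>"
      by (simp add: ginv_mult m_assoc)
    \<comment> \<open>The remaining two axioms reduce to removing a repeated factor from a product
      of the idempotents belonging to x and y.\<close>
    have *: "e \<otimes> f \<otimes> e = e \<otimes> f" "e \<otimes> f \<otimes> f = e \<otimes> f" if "e \<in> idempotents S" "f \<in> idempotents S" for e f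
      using that idempotentsD[of e] idempotentsD[of f] idempotents_comm[of e f]
      by (simp_all add: m_assoc) (simp add: m_assoc[symmetric])
    have "(x\<^sup>\<oplus>\<^bsub>?S\<^esub> \<otimes>\<^bsub>?S\<^esub> y)\<^sup>\<oplus>\<^bsub>?S\<^esub> = (x \<otimes> x\<^sup>\<dagger>) \<otimes> (y \<otimes> y\<^sup>\<dagger>) \<otimes> (x \<otimes> x\<^sup>\<dagger>)"
      by (simp add: ginv_mult ginv_ginv m_assoc)
    then show "(x\<^sup>\<oplus>\<^bsub>?S\<^esub> \<otimes>\<^bsub>?S\<^esub> y)\<^sup>\<oplus>\<^bsub>?S\<^esub> = x\<^sup>\<oplus>\<^bsub>?S\<^esub> \<otimes>\<^bsub>?S\<^esub> y\<^sup>\<oplus>\<^bsub>?S\<^esub>"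
      by (simp add: * idem)
    have "(x \<otimes>\<^bsub>?S\<^esub> y\<^sup>\<star>\<^bsub>?S\<^esub>)\<^sup>\<star>\<^bsub>?S\<^esub> = (y\<^sup>\<dagger> \<otimes> y) \<otimes> (x\<^sup>\<dagger> \<otimes> x) \<otimes> (y\<^sup>\<dagger> \<otimes> y)"
      by (simp add: ginv_mult ginv_ginv m_assoc)
    also have "\<dots> = (x\<^sup>\<dagger> \<otimes> x) \<otimes> (y\<^sup>\<dagger> \<otimes> y)"
      using idempotents_comm[OF ginv_mult_idempotent[OF x] ginv_mult_idempotent[OF y]]
      by (simp add: * idem)
    finally show "(x \<otimes>\<^bsub>?S\<^esub> y\<^sup>\<star>\<^bsub>?S\<^esub>)\<^sup>\<star>\<^bsub>?S\<^esub> = x\<^sup>\<star>\<^bsub>?S\<^esub> \<otimes>\<^bsub>?S\<^esub> y\<^sup>\<star>\<^bsub>?S\<^esub>" by simp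
  qed
  ultimately show ?thesis by (rule restriction_monoid.intro)
qed

lemma projections_restr_of_inv: "projections (restr_of_inv S) = idempotents S"
proof
  show "projections (restr_of_inv S) \<subseteq> idempotents S"
  proof
    fix e assume "e \<in> projections (restr_of_inv S)"
    then show "e \<in> idempotents S"
      using mult_ginv_idempotent[of e] by (simp add: projections_def restr_of_inv_simps)
  qed
  show "idempotents S \<subseteq> projections (restr_of_inv S)"
    by (auto simp: projections_def restr_of_inv_simps idempotentsD)
qed

text \<open>The premise \<open>gen\<close> says, as an induction principle, that Y generates S as an
  inverse monoid. The restriction submonoid H need not be closed under inverses, so the induction
  runs over conjugation of idempotents instead of membership in H.\<close>

lemma idempotents_subset_restriction_submonoid:
  assumes gen: "\<And>K. \<lbrakk>Y \<subseteq> K; \<one> \<in> K; \<And>x y. x \<in> K \<Longrightarrow> y \<in> K \<Longrightarrow> x \<otimes> y \<in> K; \<And>x. x \<in> K \<Longrightarrow> x\<^sup>\<dagger> \<in> K\<rbrakk>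
      \<Longrightarrow> carrier S \<subseteq> K"
    and Y: "Y \<subseteq> carrier S"
    and H: "restriction_submonoid H (restr_of_inv S)" and YH: "Y \<subseteq> H"
  shows "idempotents S \<subseteq> H"
proof -
  interpret H: restriction_submonoid H "restr_of_inv S" by (rule H)
  note [simp] = restr_of_inv_simps(1-3) ginv_closed
  have mH: "x \<otimes> y \<in> H" if "x \<in> H" "y \<in> H" for x y
    using H.m_closed[OF that] by simp
  \<comment> \<open>Requiring both conjugations makes K closed under inversion. Closure under
    products holds because conjugating by \<open>x \<otimes> y\<close> is conjugating twice, and the
    intermediate element is again an idempotent in H.\<close>
  define K where "K = {s \<in> carrier S. \<forall>e \<in> idempotents S \<inter> H. s \<otimes> e \<otimes> s\<^sup>\<dagger> \<in> H \<and> s\<^sup>\<dagger> \<otimes> e \<otimes> s \<in> H}"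
  have "carrier S \<subseteq> K"
  proof (rule gen)
    show "Y \<subseteq> K"
    proof
      fix y assume "y \<in> Y"
      then have "y \<in> carrier S" "y \<in> H" using Y YH by auto
      then show "y \<in> K"
        by (auto simp: K_def conj_idempotent(1,2) intro!: mH H.plus_in H.star_in)
    qed
    show "\<one> \<in> K" by (auto simp: K_def ginv_one idempotentsD)
    show "x\<^sup>\<dagger> \<in> K" if "x \<in> K" for x using that by (simp add: K_def ginv_ginv)
    show "x \<otimes> y \<in> K" if "x \<in> K" "y \<in> K" for x y
    proof -
      have [simp]: "x \<in> carrier S" "y \<in> carrier S" using that by (simp_all add: K_def)
      have "x \<otimes> y \<otimes> e \<otimes> (x \<otimes> y)\<^sup>\<dagger> \<in> H" "(x \<otimes> y)\<^sup>\<dagger> \<otimes> e \<otimes> (x \<otimes> y) \<in> H"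
        if e: "e \<in> idempotents S" "e \<in> H" for e
      proof -
        have [simp]: "e \<in> carrier S" using e(1) by (rule idempotentsD)
        have "y \<otimes> e \<otimes> y\<^sup>\<dagger> \<in> H" "x\<^sup>\<dagger> \<otimes> e \<otimes> x \<in> H"
          using e \<open>x \<in> K\<close> \<open>y \<in> K\<close> by (simp_all add: K_def)
        then have "x \<otimes> (y \<otimes> e \<otimes> y\<^sup>\<dagger>) \<otimes> x\<^sup>\<dagger> \<in> H" "y\<^sup>\<dagger> \<otimes> (x\<^sup>\<dagger> \<otimes> e \<otimes> x) \<otimes> y \<in> H"
          using conj_idempotent(3,4)[OF _ e(1)] \<open>x \<in> K\<close> \<open>y \<in> K\<close> by (simp_all add: K_def)
        then show "x \<otimes> y \<otimes> e \<otimes> (x \<otimes> y)\<^sup>\<dagger> \<in> H" "(x \<otimes> y)\<^sup>\<dagger> \<otimes> e \<otimes> (x \<otimes> y) \<in> H"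
          by (simp_all add: ginv_mult m_assoc)
      qed
      then show ?thesis by (simp add: K_def)
    qed
  qed
  \<comment> \<open>Every idempotent e now lies in K, and conjugating the identity by e gives
    \<open>e \<otimes> e\<^sup>\<dagger> = e\<close>.\<close>
  moreover have "\<one> \<in> idempotents S \<inter> H" using H.one_closed by (simp add: idempotents_def)
  ultimately have "e \<otimes> \<one> \<otimes> e\<^sup>\<dagger> \<in> H" if "e \<in> idempotents S" for e
    using idempotentsD(1)[OF that] unfolding K_def by blast
  then show ?thesis using idempotentsD by (metis r_one subsetI)
qed

end

text \<open>The image of the inverse satisfies the two regularity equations with \<open>h x\<close>,
  and inverses in T are unique.\<close>

lemma hom_ginv:
  assumes S: "inverse_monoid S" and T: "inverse_monoid T" and h: "h \<in> hom S T"
    and x: "x \<in> carrier S"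
  shows "h (x\<^sup>\<dagger>\<^bsub>S\<^esub>) = (h x)\<^sup>\<dagger>\<^bsub>T\<^esub>"
proof -
  interpret S: inverse_monoid S by (rule S)
  interpret T: inverse_monoid T by (rule T)
  have m: "h (a \<otimes>\<^bsub>S\<^esub> b) = h a \<otimes>\<^bsub>T\<^esub> h b" and c: "h a \<in> carrier T"
    if "a \<in> carrier S" "b \<in> carrier S" for a b
    using h that by (auto simp: hom_def)
  show ?thesis
    using x S.ginv_closed[OF x] arg_cong[OF S.ginv_regular[OF x], of h]
      arg_cong[OF S.ginv_regular'[OF x], of h]
    by (intro T.ginv_unique) (auto simp: m c)
qed

lemma restr_hom_restr_of_inv:
  assumes S: "inverse_monoid S" and T: "inverse_monoid T" and h: "h \<in> hom S T" "h \<one>\<^bsub>S\<^esub> = \<one>\<^bsub>T\<^esub>"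
  shows "h \<in> restr_hom (restr_of_inv S) (restr_of_inv T)"
  using h inverse_monoid.ginv_closed[OF S] hom_ginv[OF S T h(1)]
  by (auto simp: restr_hom_def restr_of_inv_def hom_def Pi_iff)

section \<open>Groups and partial bijections as inverse monoids\<close>

definition inv_of_group :: "('a, 'c) monoid_scheme \<Rightarrow> 'a inv_monoid" where
  "inv_of_group G = \<lparr>carrier = carrier G, mult = mult G, one = one G, ginv = m_inv G\<rparr>"

lemma inverse_monoid_inv_of_group:
  assumes "group G"
  shows "inverse_monoid (inv_of_group G)"
proof -
  interpret G: group G by (rule assms)
  show ?thesis
  proof
    fix x y assume "x \<in> carrier (inv_of_group G)" "y \<in> carrier (inv_of_group G)"
      and "x \<otimes>\<^bsub>inv_of_group G\<^esub> y \<otimes>\<^bsub>inv_of_group G\<^esub> x = x"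
    then have xy: "x \<in> carrier G" "y \<in> carrier G" "x \<otimes>\<^bsub>G\<^esub> y \<otimes>\<^bsub>G\<^esub> x = x"
      by (simp_all add: inv_of_group_def)
    then have "x \<otimes>\<^bsub>G\<^esub> y = \<one>\<^bsub>G\<^esub>" by (simp add: G.r_cancel_one)
    then show "y = x\<^sup>\<dagger>\<^bsub>inv_of_group G\<^esub>"
      using xy G.inv_equality[of x y] G.inv_inv[of y] by (simp add: inv_of_group_def)
  qed (auto simp: inv_of_group_def G.m_assoc)
qed

text \<open>The symmetric inverse monoid: partial bijections of E are relations that are
  single-valued in both directions, composed from left to right.\<close>

definition sym_inv_monoid :: "'a set \<Rightarrow> 'a rel inv_monoid" where
  "sym_inv_monoid E = \<lparr>carrier = {r. r \<subseteq> E \<times> E \<and> single_valued r \<and> single_valued (r\<inverse>)},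
     mult = (O), one = Id_on E, ginv = converse\<rparr>"

lemma inverse_monoid_sym_inv_monoid: "inverse_monoid (sym_inv_monoid E)"
proof (intro inverse_monoid.intro monoidI inverse_monoid_axioms.intro)
  fix x y assume "x \<in> carrier (sym_inv_monoid E)" "y \<in> carrier (sym_inv_monoid E)"
    "x \<otimes>\<^bsub>sym_inv_monoid E\<^esub> y \<otimes>\<^bsub>sym_inv_monoid E\<^esub> x = x"
    "y \<otimes>\<^bsub>sym_inv_monoid E\<^esub> x \<otimes>\<^bsub>sym_inv_monoid E\<^esub> y = y"
  then have sv: "single_valued x" "single_valued (x\<inverse>)" "single_valued y" "single_valued (y\<inverse>)"
    and eq: "x O y O x = x" "y O x O y = y" by (auto simp: sym_inv_monoid_def O_assoc)
  \<comment> \<open>A pair (a, b) of r factors through some (c, d) in s. Single-valuedness of r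
    gives c = b, that of its converse gives d = a. Hence \<open>r\<inverse> \<subseteq> s\<close>,
    and using this for x, y and for y, x yields \<open>y = x\<inverse>\<close>.\<close>
  have "(b, a) \<in> s" if "(a, b) \<in> r" "r O s O r = r" "single_valued r" "single_valued (r\<inverse>)" for a b r s
  proof -
    from that(1,2) have "(a, b) \<in> r O s O r" by simp
    then obtain c d where "(a, c) \<in> r" "(c, d) \<in> s" "(d, b) \<in> r" by blast
    with that(1,3,4) show ?thesis unfolding single_valued_def by blast
  qed
  then show "y = x\<^sup>\<dagger>\<^bsub>sym_inv_monoid E\<^esub>"
    using eq sv unfolding sym_inv_monoid_def by auto
next
  fix x assume "x \<in> carrier (sym_inv_monoid E)"
  then have sv: "single_valued x" "single_valued (x\<inverse>)" by (auto simp: sym_inv_monoid_def)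
  have *: "r O r\<inverse> O r = r" if "single_valued r" for r :: "'a rel"
  proof (intro equalityI subrelI)
    show "(a, b) \<in> r" if "(a, b) \<in> r O r\<inverse> O r" for a b
      using that \<open>single_valued r\<close> by (auto dest: single_valuedD)
  qed auto
  show "x \<otimes>\<^bsub>sym_inv_monoid E\<^esub> x\<^sup>\<dagger>\<^bsub>sym_inv_monoid E\<^esub> \<otimes>\<^bsub>sym_inv_monoid E\<^esub> x = x"
    "x\<^sup>\<dagger>\<^bsub>sym_inv_monoid E\<^esub> \<otimes>\<^bsub>sym_inv_monoid E\<^esub> x \<otimes>\<^bsub>sym_inv_monoid E\<^esub> x\<^sup>\<dagger>\<^bsub>sym_inv_monoid E\<^esub> = x\<^sup>\<dagger>\<^bsub>sym_inv_monoid E\<^esub>"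
    using *[OF sv(1)] *[OF sv(2)] by (simp_all add: sym_inv_monoid_def O_assoc)
next
  fix x y assume "x \<in> carrier (sym_inv_monoid E)" "y \<in> carrier (sym_inv_monoid E)"
  then show "x \<otimes>\<^bsub>sym_inv_monoid E\<^esub> y \<in> carrier (sym_inv_monoid E)"
    by (auto simp: sym_inv_monoid_def converse_relcomp intro!: single_valued_relcomp)
next
  show "\<one>\<^bsub>sym_inv_monoid E\<^esub> \<in> carrier (sym_inv_monoid E)"
    by (auto simp: sym_inv_monoid_def)
qed (auto simp: sym_inv_monoid_def O_assoc)

section \<open>The Munn representation\<close>

text \<open>A partial right action of a on the projections below \<open>a\<^sup>\<oplus>\<close>. In
  the reduct of an inverse monoid, e is sent to the conjugate
  \<open>a\<^sup>\<dagger> \<otimes> e \<otimes> a\<close>.\<close>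

definition munn :: "('a, 'c) restr_monoid_scheme \<Rightarrow> 'a \<Rightarrow> 'a rel" where
  "munn S a = {(e, (e \<otimes>\<^bsub>S\<^esub> a)\<^sup>\<star>\<^bsub>S\<^esub>) | e. e \<in> projections S \<and> e \<otimes>\<^bsub>S\<^esub> a\<^sup>\<oplus>\<^bsub>S\<^esub> = e}"

context restriction_monoid
begin

text \<open>A left-right symmetric form of the definition, which makes injectivity and the range
  accessible. Ampleness gives
  \<open>e \<otimes> a = a \<otimes> (e \<otimes> a)\<^sup>\<star>\<close>; conversely,
  \<open>e \<otimes> a = a \<otimes> f\<close> gives \<open>(e \<otimes> a)\<^sup>\<star> =
  a\<^sup>\<star> \<otimes> f = f\<close>.\<close>

lemma munn_iff:
  assumes a: "a \<in> carrier S"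
  shows "(e, f) \<in> munn S a \<longleftrightarrow> e \<in> projections S \<and> f \<in> projections S \<and>
    e \<otimes> a\<^sup>\<oplus> = e \<and> a\<^sup>\<star> \<otimes> f = f \<and> e \<otimes> a = a \<otimes> f"
proof
  assume "(e, f) \<in> munn S a"
  then have e: "e \<in> projections S" "e \<otimes> a\<^sup>\<oplus> = e" and f: "f = (e \<otimes> a)\<^sup>\<star>" by (auto simp: munn_def)
  have [simp]: "e \<in> carrier S" using e projections_closed by blast
  have "a\<^sup>\<star> \<otimes> f = f" using a star_mult_absorb[of e a] star_comm[of a "e \<otimes> a"] by (simp add: f)
  then show "e \<in> projections S \<and> f \<in> projections S \<and> e \<otimes> a\<^sup>\<oplus> = e \<and> a\<^sup>\<star> \<otimes> f = f \<and> e \<otimes> a = a \<otimes> f"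
    using e a projection_mult[of e a] by (simp add: f star_projection)
next
  assume *: "e \<in> projections S \<and> f \<in> projections S \<and> e \<otimes> a\<^sup>\<oplus> = e \<and> a\<^sup>\<star> \<otimes> f = f \<and> e \<otimes> a = a \<otimes> f"
  then have "(e \<otimes> a)\<^sup>\<star> = f" using a star_projection_right by metis
  with * show "(e, f) \<in> munn S a" by (auto simp: munn_def)
qed

text \<open>The values agree by \<open>star_star_mult\<close>. The content is that the domains
  agree: \<open>e \<le> (a \<otimes> b)\<^sup>\<oplus>\<close> holds exactly when
  \<open>e \<le> a\<^sup>\<oplus>\<close> and
  \<open>(e \<otimes> a)\<^sup>\<star> \<le> b\<^sup>\<oplus>\<close>.\<close>

lemma munn_mult:
  assumes [simp]: "a \<in> carrier S" "b \<in> carrier S"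
  shows "munn S (a \<otimes> b) = munn S a O munn S b"
proof (intro equalityI subrelI)
  fix e g assume "(e, g) \<in> munn S (a \<otimes> b)"
  then have e: "e \<in> projections S" and le: "e \<otimes> (a \<otimes> b)\<^sup>\<oplus> = e" and g: "g = (e \<otimes> (a \<otimes> b))\<^sup>\<star>"
    by (auto simp: munn_def)
  have [simp]: "e \<in> carrier S" using e projections_closed by blast
  have "e \<otimes> a\<^sup>\<oplus> = e"
    using le plus_mult_absorb[of a b] by (metis assms \<open>e \<in> carrier S\<close> m_assoc m_closed plus_closed)
  then have "(e, (e \<otimes> a)\<^sup>\<star>) \<in> munn S a" using e by (auto simp: munn_def)
  \<comment> \<open>Ampleness moves \<open>b\<^sup>\<oplus>\<close> to the left of a, where it
    becomes \<open>(a \<otimes> b)\<^sup>\<oplus>\<close> and is absorbed by e.\<close>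
  moreover have "(e \<otimes> a)\<^sup>\<star> \<otimes> b\<^sup>\<oplus> = (e \<otimes> a)\<^sup>\<star>"
  proof -
    have "(e \<otimes> a)\<^sup>\<star> \<otimes> b\<^sup>\<oplus> = (e \<otimes> (a \<otimes> b\<^sup>\<oplus>))\<^sup>\<star>"
      using star_projection_right[OF plus_projection[of b], of "e \<otimes> a"]
      by (simp add: m_assoc plus_closed)
    also have "e \<otimes> (a \<otimes> b\<^sup>\<oplus>) = e \<otimes> (a \<otimes> b)\<^sup>\<oplus> \<otimes> a"
      using plus_ample[of a b] by (simp add: m_assoc plus_closed)
    finally show ?thesis by (simp add: le)
  qed
  moreover have "g = ((e \<otimes> a)\<^sup>\<star> \<otimes> b)\<^sup>\<star>" using star_star_mult[of "e \<otimes> a" b] by (simp add: g m_assoc)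
  ultimately show "(e, g) \<in> munn S a O munn S b"
    using star_projection[of "e \<otimes> a"] by (fastforce simp: munn_def)
next
  fix e g assume "(e, g) \<in> munn S a O munn S b"
  then obtain f where f: "f = (e \<otimes> a)\<^sup>\<star>" "f \<in> projections S" "f \<otimes> b\<^sup>\<oplus> = f" "(e, f) \<in> munn S a"
    and e: "e \<in> projections S" "e \<otimes> a\<^sup>\<oplus> = e" and g: "g = (f \<otimes> b)\<^sup>\<star>" by (auto simp: munn_def)
  have [simp]: "e \<in> carrier S" "f \<in> carrier S" using e f projections_closed by auto
  have af: "e \<otimes> a = a \<otimes> f" using f(4) munn_iff by simp
  have "e \<otimes> (a \<otimes> b)\<^sup>\<oplus> = (e \<otimes> a \<otimes> b)\<^sup>\<oplus>"
    using plus_projection_left[OF e(1), of "a \<otimes> b"] by (simp add: m_assoc)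
  also have "\<dots> = (e \<otimes> a \<otimes> b\<^sup>\<oplus>)\<^sup>\<oplus>" using plus_mult_plus[of "e \<otimes> a" b] by simp
  also have "e \<otimes> a \<otimes> b\<^sup>\<oplus> = e \<otimes> a" using f(3) by (simp add: af m_assoc plus_closed)
  also have "(e \<otimes> a)\<^sup>\<oplus> = e" using plus_projection_left[OF e(1), of a] e(2) by simp
  finally have "e \<otimes> (a \<otimes> b)\<^sup>\<oplus> = e" .
  moreover have "g = (e \<otimes> (a \<otimes> b))\<^sup>\<star>"
    using star_star_mult[of "e \<otimes> a" b] by (simp add: g f(1) m_assoc)
  ultimately show "(e, g) \<in> munn S (a \<otimes> b)" using e(1) by (auto simp: munn_def)
qed

lemma munn_projection:
  assumes "p \<in> projections S"
  shows "munn S p = {(e, e) | e. e \<in> projections S \<and> e \<otimes> p = e}"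
proof -
  have "(e \<otimes> p)\<^sup>\<star> = e" if "e \<in> projections S" "e \<otimes> p = e" for e
    using that by (simp add: projections_star)
  then show ?thesis using projections_plus[OF assms] by (fastforce simp: munn_def)
qed

text \<open>Just as f is \<open>(e \<otimes> a)\<^sup>\<star>\<close>, the symmetric form recovers e
  as \<open>(a \<otimes> f)\<^sup>\<oplus>\<close>.\<close>

lemma munn_single_valued:
  assumes a: "a \<in> carrier S"
  shows "single_valued (munn S a)" "single_valued ((munn S a)\<inverse>)"
proof -
  show "single_valued (munn S a)" by (auto simp: munn_def single_valued_def)
  have "e = (a \<otimes> f)\<^sup>\<oplus>" if "(e, f) \<in> munn S a" for e f
    using that a plus_projection_left[of e a] by (simp add: munn_iff)
  then show "single_valued ((munn S a)\<inverse>)" by (auto simp: single_valued_def)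
qed

lemma munn_hom: "munn S \<in> restr_hom S (restr_of_inv (sym_inv_monoid (projections S)))"
proof -
  have c: "munn S a \<in> carrier (sym_inv_monoid (projections S))" if "a \<in> carrier S" for a
    using munn_single_valued[OF that] by (auto simp: sym_inv_monoid_def munn_iff[OF that])
  have one: "munn S \<one> = Id_on (projections S)"
    unfolding munn_projection[OF one_projection] using projections_closed by (auto simp: Id_on_def)
  have plus: "munn S (a\<^sup>\<oplus>) = munn S a O (munn S a)\<inverse>" if a: "a \<in> carrier S" for a
  proof -
    \<comment> \<open>A partial bijection followed by its converse is the identity on its domain. So
      \<open>plus\<close> amounts to computing the domain of \<open>munn S a\<close>, and
      \<open>star\<close> its range.\<close>
    have "munn S a O (munn S a)\<inverse> = Id_on (Domain (munn S a))"
      using munn_single_valued(2)[OF a] unfolding single_valued_def by blast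
    moreover have "Domain (munn S a) = {e \<in> projections S. e \<otimes> a\<^sup>\<oplus> = e}"
      by (auto simp: munn_def)
    ultimately show ?thesis by (auto simp: munn_projection[OF plus_projection[OF a]] Id_on_def)
  qed
  have star: "munn S (a\<^sup>\<star>) = (munn S a)\<inverse> O munn S a" if a: "a \<in> carrier S" for a
  proof -
    have "(munn S a)\<inverse> O munn S a = Id_on (Range (munn S a))"
      using munn_single_valued(1)[OF a] unfolding single_valued_def by blast
    moreover have "Range (munn S a) = {f \<in> projections S. f \<otimes> a\<^sup>\<star> = f}"
    proof (intro equalityI subsetI)
      fix f assume "f \<in> Range (munn S a)"
      then show "f \<in> {f \<in> projections S. f \<otimes> a\<^sup>\<star> = f}"
        using projections_comm[OF star_projection[OF a], of f] by (auto simp: munn_iff[OF a])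
    next
      fix f assume "f \<in> {f \<in> projections S. f \<otimes> a\<^sup>\<star> = f}"
      then have f: "f \<in> projections S" "a\<^sup>\<star> \<otimes> f = f"
        using projections_comm[OF star_projection[OF a], of f] by auto
      have [simp]: "f \<in> carrier S" using f projections_closed by blast
      \<comment> \<open>The preimage of f is \<open>(a \<otimes> f)\<^sup>\<oplus>\<close>: it lies
        below \<open>a\<^sup>\<oplus>\<close>, and multiplying it by a gives
        \<open>a \<otimes> f\<close>.\<close>
      have "(a \<otimes> f)\<^sup>\<oplus> \<otimes> a\<^sup>\<oplus> = (a \<otimes> f)\<^sup>\<oplus>" using a by (simp add: plus_mult_absorb)
      then have "((a \<otimes> f)\<^sup>\<oplus>, f) \<in> munn S a"
        using f a mult_projection[of f a] by (simp add: munn_iff plus_projection)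
      then show "f \<in> Range (munn S a)" by blast
    qed
    ultimately show ?thesis by (auto simp: munn_projection[OF star_projection[OF a]] Id_on_def)
  qed
  show ?thesis
    using c one plus star munn_mult
    by (auto simp: restr_hom_def hom_def restr_of_inv_def sym_inv_monoid_def)
qed

text \<open>A projection p acts as the identity on the projections below it, and p is the largest of
  these.\<close>

lemma munn_inj_on_projections: "inj_on (munn S) (projections S)"
proof
  fix p q assume p: "p \<in> projections S" and q: "q \<in> projections S" and eq: "munn S p = munn S q"
  have "(p, p) \<in> munn S p" "(q, q) \<in> munn S q"
    using p q by (simp_all add: munn_projection projections_idem)
  then have "p \<otimes> q = p" "q \<otimes> p = q"
    using eq p q by (auto simp: munn_projection)
  then show "p = q" using projections_comm[OF p q] by simp
qed

end

section \<open>Quotients and universal properties\<close>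

lemma rterm_eval_hom:
  assumes S: "restriction_monoid S" and h: "h \<in> restr_hom S T" and g: "g \<in> A \<rightarrow> carrier S"
    and t: "set_rterm t \<subseteq> A"
  shows "h (rterm_eval S g t) = rterm_eval T (\<lambda>a. h (g a)) t"
  using t by (induction t) (auto simp: restr_homD[OF h] rterm_eval_closed[OF S g])

text \<open>A term representing p turns the definite description behind \<open>id_value\<close> into
  term evaluation, which commutes with morphisms.\<close>

lemma id_value_hom:
  assumes M: "monoid M" and S: "restriction_monoid S" and T: "restriction_monoid T"
    and h: "h \<in> restr_hom S T" and \<iota>: "\<iota> \<in> carrier M \<rightarrow> carrier S" and f: "f \<in> X \<rightarrow> carrier M"
    and p: "p \<in> carrier (FR (lists X))"
  shows "id_value X M S \<iota> f p \<in> carrier S"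
    and "h (id_value X M S \<iota> f p) = id_value X M T (\<lambda>m. h (\<iota> m)) f p"
proof -
  obtain t where t: "set_rterm t \<subseteq> lists X" "p = FR_class (lists X) t"
    using p by (auto simp: FR_simps)
  have g: "(\<lambda>u. \<iota> (word_ext M f u)) \<in> lists X \<rightarrow> carrier S"
    using word_ext_closed[OF M f] \<iota> by blast
  then have hg: "(\<lambda>u. h (\<iota> (word_ext M f u))) \<in> lists X \<rightarrow> carrier T"
    using restr_homD(1)[OF h] by blast
  show "id_value X M S \<iota> f p \<in> carrier S"
    unfolding id_value_def t(2) FR_value_eq[OF S g t(1)] by (rule rterm_eval_closed[OF S g t(1)])
  show "h (id_value X M S \<iota> f p) = id_value X M T (\<lambda>m. h (\<iota> m)) f p"
    unfolding id_value_def t(2) FR_value_eq[OF S g t(1)] FR_value_eq[OF T hg t(1)]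
    by (rule rterm_eval_hom[OF S h g t(1)])
qed

section \<open>Premorphisms satisfying the identities, and the defining relations\<close>

text \<open>These are the maps classified by both presentations: \<open>FRR\<close> is universal for
  them among restriction monoids, \<open>FIR\<close> among inverse monoids.\<close>

definition R_premorphism :: "'x set \<Rightarrow> 'x identity set \<Rightarrow> ('m, 'c) monoid_scheme \<Rightarrow>
    ('s, 'd) restr_monoid_scheme \<Rightarrow> ('m \<Rightarrow> 's) \<Rightarrow> bool" where
  "R_premorphism X R M S \<gamma> \<longleftrightarrow> \<gamma> \<in> carrier M \<rightarrow> carrier S \<and> \<gamma> \<one>\<^bsub>M\<^esub> = \<one>\<^bsub>S\<^esub> \<and>
     (\<forall>m\<in>carrier M. \<forall>n\<in>carrier M.
        \<gamma> m \<otimes>\<^bsub>S\<^esub> \<gamma> n = \<gamma> (m \<otimes>\<^bsub>M\<^esub> n) \<otimes>\<^bsub>S\<^esub> (\<gamma> m \<otimes>\<^bsub>S\<^esub> \<gamma> n)\<^sup>\<star>\<^bsub>S\<^esub>) \<and>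
     (\<forall>pq\<in>R. satisfies X M S \<gamma> pq)"

text \<open>Maps extended from generators agree with the given one only on \<open>carrier M\<close>.
  That is enough, because \<open>id_value\<close> evaluates the map only at values of words, which
  lie in the carrier.\<close>

lemma R_premorphism_cong:
  assumes M: "monoid M" and eq: "\<And>m. m \<in> carrier M \<Longrightarrow> \<gamma> m = \<delta> m"
    and T: "restriction_monoid T" and R: "R \<subseteq> identities X" and \<gamma>: "R_premorphism X R M T \<delta>"
  shows "R_premorphism X R M T \<gamma>"
proof -
  interpret M: monoid M by (rule M)
  have \<delta>: "\<delta> \<in> carrier M \<rightarrow> carrier T" using \<gamma> by (simp add: R_premorphism_def)
  have "id_value X M T \<gamma> f p = id_value X M T \<delta> f p"
    if f: "f \<in> X \<rightarrow> carrier M" and p: "p \<in> carrier (FR (lists X))" for f p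
  proof -
    obtain t where t: "set_rterm t \<subseteq> lists X" "p = FR_class (lists X) t"
      using p by (auto simp: FR_simps)
    note w = word_ext_closed[OF M f]
    have g: "(\<lambda>u. \<gamma> (word_ext M f u)) \<in> lists X \<rightarrow> carrier T"
        "(\<lambda>u. \<delta> (word_ext M f u)) \<in> lists X \<rightarrow> carrier T"
      using w \<delta> eq by (auto simp: Pi_iff)
    have "rterm_eval T (\<lambda>u. \<gamma> (word_ext M f u)) t = rterm_eval T (\<lambda>u. \<delta> (word_ext M f u)) t"
      using t(1) w eq by (induction t) auto
    then show ?thesis
      using t by (simp add: id_value_def FR_value_eq[OF T g(1)] FR_value_eq[OF T g(2)])
  qed
  then have "satisfies X M T \<gamma> pq \<longleftrightarrow> satisfies X M T \<delta> pq" if "pq \<in> R" for pq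
    using that R by (auto simp: satisfies_def identities_def)
  then show ?thesis using \<gamma> eq by (auto simp: R_premorphism_def Pi_iff)
qed

lemma presentation_rel_closed:
  assumes M: "monoid M" and S: "restriction_monoid S" and R: "R \<subseteq> identities X"
    and \<iota>: "\<iota> \<in> carrier M \<rightarrow> carrier S"
  shows "premorphism_rel M S \<iota> \<union> identity_rel X R M S \<iota> \<subseteq> carrier S \<times> carrier S"
proof -
  interpret S: restriction_monoid S by (rule S)
  \<comment> \<open>The identity of S serves as the morphism in \<open>id_value_hom\<close>, whose
    first part is the closure needed here.\<close>
  have "(\<lambda>x. x) \<in> restr_hom S S" by (auto simp: restr_hom_def hom_def)
  note closed = id_value_hom(1)[OF M S S this \<iota>]
  have "identity_rel X R M S \<iota> \<subseteq> carrier S \<times> carrier S"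
    unfolding identity_rel_def
  proof clarify
    fix f p q assume "(p, q) \<in> R" and f: "f \<in> X \<rightarrow> carrier M"
    then have "p \<in> carrier (FR (lists X))" "q \<in> carrier (FR (lists X))"
      using R unfolding identities_def by blast+
    then show "id_value X M S \<iota> f p \<in> carrier S \<and> id_value X M S \<iota> f q \<in> carrier S"
      using closed[OF f] by blast
  qed
  moreover have "premorphism_rel M S \<iota> \<subseteq> carrier S \<times> carrier S"
    using \<iota> M by (auto simp: premorphism_rel_def Pi_iff monoid.one_closed monoid.m_closed S.star_closed)
  ultimately show ?thesis by simp
qed

text \<open>Pushing the relations through k gives the premorphism laws and the identities in T. With
  k a quotient map this shows that the generators of a presentation form an R-premorphism; with k an
  extension to a free object, that the extension factors through the presentation.\<close>

lemma R_premorphism_iff_kernel: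
  assumes M: "monoid M" and S: "restriction_monoid S" and T: "restriction_monoid T"
    and R: "R \<subseteq> identities X"
    and k: "k \<in> restr_hom S T" and \<iota>: "\<iota> \<in> carrier M \<rightarrow> carrier S"
  shows "R_premorphism X R M T (\<lambda>m. k (\<iota> m)) \<longleftrightarrow>
    (\<forall>(x, y) \<in> premorphism_rel M S \<iota> \<union> identity_rel X R M S \<iota>. k x = k y)"
proof -
  interpret S: restriction_monoid S by (rule S)
  interpret M: monoid M by (rule M)
  note kD = restr_homD[OF k]
  have c [simp]: "\<iota> m \<in> carrier S" if "m \<in> carrier M" for m using \<iota> that by blast
  have "(\<forall>(x, y) \<in> premorphism_rel M S \<iota>. k x = k y) \<longleftrightarrow> k (\<iota> \<one>\<^bsub>M\<^esub>) = \<one>\<^bsub>T\<^esub> \<and>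
     (\<forall>m\<in>carrier M. \<forall>n\<in>carrier M. k (\<iota> m) \<otimes>\<^bsub>T\<^esub> k (\<iota> n) =
        k (\<iota> (m \<otimes>\<^bsub>M\<^esub> n)) \<otimes>\<^bsub>T\<^esub> (k (\<iota> m) \<otimes>\<^bsub>T\<^esub> k (\<iota> n))\<^sup>\<star>\<^bsub>T\<^esub>)"
  proof -
    have "(\<forall>(x, y) \<in> premorphism_rel M S \<iota>. k x = k y) \<longleftrightarrow> k (\<iota> \<one>\<^bsub>M\<^esub>) = k \<one>\<^bsub>S\<^esub> \<and>
       (\<forall>m\<in>carrier M. \<forall>n\<in>carrier M. k (\<iota> m \<otimes>\<^bsub>S\<^esub> \<iota> n) =
          k (\<iota> (m \<otimes>\<^bsub>M\<^esub> n) \<otimes>\<^bsub>S\<^esub> (\<iota> m \<otimes>\<^bsub>S\<^esub> \<iota> n)\<^sup>\<star>\<^bsub>S\<^esub>))"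
      unfolding premorphism_rel_def by blast
    then show ?thesis by (simp add: kD S.star_closed)
  qed
  moreover have "(\<forall>(x, y) \<in> identity_rel X R M S \<iota>. k x = k y) \<longleftrightarrow>
      (\<forall>pq\<in>R. satisfies X M T (\<lambda>m. k (\<iota> m)) pq)"
  proof -
    have eq: "k (id_value X M S \<iota> f p) = id_value X M T (\<lambda>m. k (\<iota> m)) f p"
         "k (id_value X M S \<iota> f q) = id_value X M T (\<lambda>m. k (\<iota> m)) f q"
      if "(p, q) \<in> R" "f \<in> X \<rightarrow> carrier M" for p q f
      using that R by (auto intro!: id_value_hom(2)[OF M S T k \<iota>] simp: identities_def)
    have "(\<forall>(x, y) \<in> identity_rel X R M S \<iota>. k x = k y) \<longleftrightarrow>
        (\<forall>(p, q)\<in>R. \<forall>f\<in>X \<rightarrow> carrier M. k (id_value X M S \<iota> f p) = k (id_value X M S \<iota> f q))"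
      unfolding identity_rel_def by blast
    also have "\<dots> \<longleftrightarrow> (\<forall>pq\<in>R. satisfies X M T (\<lambda>m. k (\<iota> m)) pq)"
      unfolding satisfies_def using eq by (intro ball_cong refl) (auto simp del: Pi_iff)
    finally show ?thesis .
  qed
  ultimately show ?thesis using kD(1) by (auto simp: R_premorphism_def ball_Un)
qed

lemma restr_quot_hom:
  assumes "restriction_monoid S" "restr_congruence S \<rho>"
  shows "(\<lambda>x. \<rho> `` {x}) \<in> restr_hom S (restr_quot S \<rho>)"
  using assms by (auto simp: restr_hom_def hom_def restr_quot_simps)

text \<open>The kernel of k is a congruence containing \<open>Rel\<close>, and its quotient is a
  restriction monoid because S satisfies the axioms already. Hence it contains the generated
  congruence, and k is constant on the classes.\<close>

lemma restr_quot_gen_universal: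
  assumes S: "restriction_monoid S" and T: "restriction_monoid T" and k: "k \<in> restr_hom S T"
    and Rel: "Rel \<subseteq> carrier S \<times> carrier S" and ker: "\<forall>(x, y) \<in> Rel. k x = k y"
  shows "\<exists>h \<in> restr_hom (restr_quot S (restr_cong_gen S Rel)) T.
    \<forall>x\<in>carrier S. h (restr_cong_gen S Rel `` {x}) = k x"
proof -
  interpret S: restriction_monoid S by (rule S)
  interpret T: restriction_monoid T by (rule T)
  note kD = restr_homD[OF k]
  define \<kappa> where "\<kappa> = {(x, y). x \<in> carrier S \<and> y \<in> carrier S \<and> k x = k y}"
  define \<rho> where "\<rho> = restr_cong_gen S Rel"
  have c: "restr_congruence S \<kappa>"
    unfolding restr_congruence_def \<kappa>_def
    by (auto simp: kD equiv_def refl_on_def sym_def trans_def S.star_closed S.plus_closed)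
  have "restr_ax_pairs S \<subseteq> \<kappa>"
    unfolding restr_ax_pairs_def \<kappa>_def Let_def
    by (auto simp: S.m_assoc S.plus_left S.star_right
        S.star_of_plus S.plus_of_star S.star_star S.plus_plus S.star_closed S.plus_closed
        intro!: arg_cong[of _ _ k] S.plus_comm S.star_comm S.plus_ample S.star_ample)
  then have "restriction_monoid (restr_quot S \<kappa>)"
    using restriction_monoid_quot_iff[OF c restriction_monoid_closed[OF S]] by blast
  with c Rel ker have \<rho>\<kappa>: "\<rho> \<subseteq> \<kappa>"
    unfolding restr_cong_gen_def \<kappa>_def \<rho>_def by blast
  have \<rho>: "restr_congruence S \<rho>"
    unfolding \<rho>_def by (rule restr_cong_gen_props[OF restriction_monoid_closed[OF S] Rel])
  then have eq: "equiv (carrier S) \<rho>" by (simp add: restr_congruence_def)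
  \<comment> \<open>The choice of representative is immaterial by
    \<open>\<rho>\<kappa>\<close>.\<close>
  define h where "h c = k (SOME x. x \<in> c)" for c
  have h: "h (\<rho> `` {x}) = k x" if "x \<in> carrier S" for x
  proof -
    have "x \<in> \<rho> `` {x}" using equiv_class_self[OF eq that] .
    then have "(SOME y. y \<in> \<rho> `` {x}) \<in> \<rho> `` {x}" by (rule someI)
    then show ?thesis unfolding h_def using \<rho>\<kappa> by (auto simp: \<kappa>_def)
  qed
  have "h \<in> restr_hom (restr_quot S \<rho>) T"
    unfolding restr_hom_def hom_def
    by (auto simp: restr_quot_simps[OF \<rho>] h kD S.star_closed S.plus_closed)
  then show ?thesis using h by (auto simp: \<rho>_def)
qed

lemma FR_generated:
  assumes K: "FR_gen A ` A \<subseteq> K" and H: "restriction_submonoid K (FR A)"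
  shows "carrier (FR A) \<subseteq> K"
proof -
  interpret restriction_submonoid K "FR A" by (rule H)
  have "FR_class A t \<in> K" if "set_rterm t \<subseteq> A" for t
    using that
  proof (induction t)
    case (RGen a)
    then have "FR_gen A a \<in> K" using K by auto
    then show ?case by (simp add: FR_gen_def)
  next
    case (RMult s t)
    then show ?case using m_closed[of "FR_class A s" "FR_class A t"] by (simp add: FR_simps)
  next
    case (RStar t)
    then show ?case using star_in[of "FR_class A t"] by (simp add: FR_simps)
  next
    case (RPlus t)
    then show ?case using plus_in[of "FR_class A t"] by (simp add: FR_simps)
  qed (use one_closed in \<open>simp add: FR_simps\<close>)
  then show ?thesis by (auto simp: FR_simps)
qed

lemma FR_gen_Pi: "FR_gen A \<in> A \<rightarrow> carrier (FR A)"
  by (intro Pi_I FR_gen_closed)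

section \<open>The presented restriction monoid \<open>FRR\<close>\<close>

definition FRR_gen :: "'x set \<Rightarrow> 'x identity set \<Rightarrow> ('m, 'c) monoid_scheme \<Rightarrow>
    'm \<Rightarrow> 'm rterm set set" where
  "FRR_gen X R M m = FRR_cong X R M `` {FR_gen (carrier M) m}"

context
  fixes M :: "('m, 'c) monoid_scheme" and X :: "'x set" and R :: "'x identity set"
  assumes M: "monoid M" and R: "R \<subseteq> identities X"
begin

lemmas FRR_rel_closed = presentation_rel_closed[OF M restriction_monoid_FR R FR_gen_Pi]

lemmas FRR_cong_props =
  restr_cong_gen_props[OF restriction_monoid_closed[OF restriction_monoid_FR] FRR_rel_closed,
    folded FRR_cong_def[of X R M, unfolded Let_def], folded FRR_def]

lemma restriction_monoid_FRR: "restriction_monoid (FRR X R M)"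
  by (rule FRR_cong_props)

lemma FRR_proj_hom: "(\<lambda>x. FRR_cong X R M `` {x}) \<in> restr_hom (FR (carrier M)) (FRR X R M)"
  unfolding FRR_def by (rule restr_quot_hom[OF restriction_monoid_FR FRR_cong_props(1)])

lemma R_premorphism_FRR_gen: "R_premorphism X R M (FRR X R M) (FRR_gen X R M)"
proof -
  have "equiv (carrier (FR (carrier M))) (FRR_cong X R M)"
    using FRR_cong_props(1) by (simp add: restr_congruence_def)
  then show ?thesis
    unfolding FRR_gen_def
      R_premorphism_iff_kernel[OF M restriction_monoid_FR restriction_monoid_FRR R FRR_proj_hom FR_gen_Pi]
    using FRR_cong_props(3) by (auto dest: equiv_class_eq)
qed

text \<open>The extension k of \<open>\<gamma>\<close> to the free restriction monoid identifies the
  two sides of each defining relation, so it factors through the quotient.\<close>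

lemma FRR_universal:
  assumes T: "restriction_monoid T" and \<gamma>: "R_premorphism X R M T \<gamma>"
  shows "\<exists>h \<in> restr_hom (FRR X R M) T. \<forall>m\<in>carrier M. h (FRR_gen X R M m) = \<gamma> m"
proof -
  have "\<gamma> \<in> carrier M \<rightarrow> carrier T" using \<gamma> by (simp add: R_premorphism_def)
  from FR_hom_exists[OF T this] obtain k where k: "k \<in> restr_hom (FR (carrier M)) T"
    and kg: "\<And>m. m \<in> carrier M \<Longrightarrow> k (FR_gen (carrier M) m) = \<gamma> m" by blast
  have "R_premorphism X R M T (\<lambda>m. k (FR_gen (carrier M) m))"
    using R_premorphism_cong[OF M kg T R \<gamma>] .
  then have "\<forall>(x, y) \<in> premorphism_rel M (FR (carrier M)) (FR_gen (carrier M)) \<union>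
      identity_rel X R M (FR (carrier M)) (FR_gen (carrier M)). k x = k y"
    by (simp only: R_premorphism_iff_kernel[OF M restriction_monoid_FR T R k FR_gen_Pi])
  from restr_quot_gen_universal[OF restriction_monoid_FR T k FRR_rel_closed this]
  obtain h where "h \<in> restr_hom (FRR X R M) T"
    and h: "\<And>x. x \<in> carrier (FR (carrier M)) \<Longrightarrow> h (FRR_cong X R M `` {x}) = k x"
    unfolding FRR_def FRR_cong_def Let_def by blast
  moreover have "h (FRR_gen X R M m) = \<gamma> m" if "m \<in> carrier M" for m
    using that by (simp add: FRR_gen_def h FR_gen_closed kg)
  ultimately show ?thesis by blast
qed

text \<open>The preimage of K under the quotient map is a restriction submonoid containing the free
  generators. The lemma serves as the induction principle for \<open>FRR\<close>.\<close>

lemma FRR_generated: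
  assumes K: "FRR_gen X R M ` carrier M \<subseteq> K" and H: "restriction_submonoid K (FRR X R M)"
  shows "carrier (FRR X R M) \<subseteq> K"
proof -
  interpret restriction_submonoid K "FRR X R M" by (rule H)
  interpret F: restriction_monoid "FR (carrier M)" by (rule restriction_monoid_FR)
  let ?\<pi> = "\<lambda>x. FRR_cong X R M `` {x}"
  note pD = restr_homD[OF FRR_proj_hom]
  have "carrier (FR (carrier M)) \<subseteq> {x \<in> carrier (FR (carrier M)). ?\<pi> x \<in> K}"
  proof (rule FR_generated)
    show "FR_gen (carrier M) ` carrier M \<subseteq> {x \<in> carrier (FR (carrier M)). ?\<pi> x \<in> K}"
      using K by (auto simp: FRR_gen_def FR_gen_closed)
    show "restriction_submonoid {x \<in> carrier (FR (carrier M)). ?\<pi> x \<in> K} (FR (carrier M))"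
      by unfold_locales (auto simp: pD one_closed m_closed star_in plus_in F.star_closed F.plus_closed)
  qed
  then show ?thesis
    using restr_quot_simps(5)[OF FRR_cong_props(1)] unfolding FRR_def by auto
qed

end

section \<open>Inverse monoids by generators and relations\<close>

definition inv_closed :: "('a, 'c) inv_monoid_scheme \<Rightarrow> bool" where
  "inv_closed S \<longleftrightarrow> \<one>\<^bsub>S\<^esub> \<in> carrier S \<and>
     (\<forall>x\<in>carrier S. \<forall>y\<in>carrier S. x \<otimes>\<^bsub>S\<^esub> y \<in> carrier S) \<and>
     (\<forall>x\<in>carrier S. x\<^sup>\<dagger>\<^bsub>S\<^esub> \<in> carrier S)"

lemma inverse_monoid_closed: "inverse_monoid S \<Longrightarrow> inv_closed S"
  unfolding inv_closed_def
  by (simp add: inverse_monoid.ginv_closed inverse_monoid.axioms(1) monoid.m_closed monoid.one_closed)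

lemma inv_quot_simps:
  assumes \<rho>: "inv_congruence S \<rho>"
  shows "x \<in> carrier S \<Longrightarrow> y \<in> carrier S \<Longrightarrow> \<rho> `` {x} \<otimes>\<^bsub>inv_quot S \<rho>\<^esub> \<rho> `` {y} = \<rho> `` {x \<otimes>\<^bsub>S\<^esub> y}"
    and "\<one>\<^bsub>inv_quot S \<rho>\<^esub> = \<rho> `` {\<one>\<^bsub>S\<^esub>}"
    and "x \<in> carrier S \<Longrightarrow> (\<rho> `` {x})\<^sup>\<dagger>\<^bsub>inv_quot S \<rho>\<^esub> = \<rho> `` {x\<^sup>\<dagger>\<^bsub>S\<^esub>}"
    and "carrier (inv_quot S \<rho>) = (\<lambda>x. \<rho> `` {x}) ` carrier S"
proof -
  have eq: "equiv (carrier S) \<rho>" using \<rho> by (simp add: inv_congruence_def)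
  have cl: "\<rho> `` {a} = \<rho> `` {b}" if "(a, b) \<in> \<rho>" for a b
    using equiv_class_eq[OF eq that] .
  show "\<rho> `` {x} \<otimes>\<^bsub>inv_quot S \<rho>\<^esub> \<rho> `` {y} = \<rho> `` {x \<otimes>\<^bsub>S\<^esub> y}"
    if "x \<in> carrier S" "y \<in> carrier S"
  proof -
    have "congruent2 \<rho> \<rho> (\<lambda>x y. \<rho> `` {x \<otimes>\<^bsub>S\<^esub> y})"
      using \<rho> by (auto intro!: congruent2I' cl simp: inv_congruence_def)
    from UN_equiv_class2[OF eq eq this that] show ?thesis by (simp add: inv_quot_def)
  qed
  show "(\<rho> `` {x})\<^sup>\<dagger>\<^bsub>inv_quot S \<rho>\<^esub> = \<rho> `` {x\<^sup>\<dagger>\<^bsub>S\<^esub>}" if "x \<in> carrier S"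
  proof -
    have "congruent \<rho> (\<lambda>x. \<rho> `` {x\<^sup>\<dagger>\<^bsub>S\<^esub>})"
      using \<rho> by (auto intro!: congruentI cl simp: inv_congruence_def)
    from UN_equiv_class[OF eq this that] show ?thesis by (simp add: inv_quot_def)
  qed
qed (auto simp: inv_quot_def quotient_def)

text \<open>Uniqueness of inverses is a Horn clause, so congruences satisfying it are closed under
  intersection.\<close>

definition inv_axioms_mod :: "('a, 'c) inv_monoid_scheme \<Rightarrow> 'a rel \<Rightarrow> bool" where
  "inv_axioms_mod S \<rho> \<longleftrightarrow>
     (\<forall>x\<in>carrier S. \<forall>y\<in>carrier S. \<forall>z\<in>carrier S.
        (x \<otimes>\<^bsub>S\<^esub> y \<otimes>\<^bsub>S\<^esub> z, x \<otimes>\<^bsub>S\<^esub> (y \<otimes>\<^bsub>S\<^esub> z)) \<in> \<rho>) \<and>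
     (\<forall>x\<in>carrier S. (\<one>\<^bsub>S\<^esub> \<otimes>\<^bsub>S\<^esub> x, x) \<in> \<rho> \<and> (x \<otimes>\<^bsub>S\<^esub> \<one>\<^bsub>S\<^esub>, x) \<in> \<rho> \<and>
        (x \<otimes>\<^bsub>S\<^esub> x\<^sup>\<dagger>\<^bsub>S\<^esub> \<otimes>\<^bsub>S\<^esub> x, x) \<in> \<rho> \<and> (x\<^sup>\<dagger>\<^bsub>S\<^esub> \<otimes>\<^bsub>S\<^esub> x \<otimes>\<^bsub>S\<^esub> x\<^sup>\<dagger>\<^bsub>S\<^esub>, x\<^sup>\<dagger>\<^bsub>S\<^esub>) \<in> \<rho>) \<and>
     (\<forall>x\<in>carrier S. \<forall>y\<in>carrier S. (x \<otimes>\<^bsub>S\<^esub> y \<otimes>\<^bsub>S\<^esub> x, x) \<in> \<rho> \<longrightarrow> (y \<otimes>\<^bsub>S\<^esub> x \<otimes>\<^bsub>S\<^esub> y, y) \<in> \<rho> \<longrightarrow>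
        (y, x\<^sup>\<dagger>\<^bsub>S\<^esub>) \<in> \<rho>)"

text \<open>This replaces the condition on the quotient in \<open>inv_cong_gen\<close> by closure
  conditions on the relation itself, which survive intersections.\<close>

lemma inverse_monoid_quot_iff:
  assumes \<rho>: "inv_congruence S \<rho>" and S: "inv_closed S"
  shows "inverse_monoid (inv_quot S \<rho>) \<longleftrightarrow> inv_axioms_mod S \<rho>"
proof -
  have eq: "equiv (carrier S) \<rho>" using \<rho> by (simp add: inv_congruence_def)
  have cl: "(\<rho> `` {a} = \<rho> `` {b}) \<longleftrightarrow> (a, b) \<in> \<rho>" if "a \<in> carrier S" "b \<in> carrier S" for a b
    using eq_equiv_class_iff[OF eq that] .
  have [simp]: "x \<otimes>\<^bsub>S\<^esub> y \<in> carrier S" if "x \<in> carrier S" "y \<in> carrier S" for x y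
    using S that by (simp add: inv_closed_def)
  have [simp]: "\<one>\<^bsub>S\<^esub> \<in> carrier S" using S by (simp add: inv_closed_def)
  have [simp]: "x\<^sup>\<dagger>\<^bsub>S\<^esub> \<in> carrier S" if "x \<in> carrier S" for x
    using S that by (simp add: inv_closed_def)
  have img: "(\<forall>a. a \<in> (\<lambda>x. \<rho> `` {x}) ` carrier S \<longrightarrow> P a) \<longleftrightarrow> (\<forall>x\<in>carrier S. P (\<rho> `` {x}))" for P
    by blast
  have "monoid (inv_quot S \<rho>) \<longleftrightarrow>
     (\<forall>x\<in>carrier S. \<forall>y\<in>carrier S. \<forall>z\<in>carrier S.
        (x \<otimes>\<^bsub>S\<^esub> y \<otimes>\<^bsub>S\<^esub> z, x \<otimes>\<^bsub>S\<^esub> (y \<otimes>\<^bsub>S\<^esub> z)) \<in> \<rho>) \<and>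
     (\<forall>x\<in>carrier S. (\<one>\<^bsub>S\<^esub> \<otimes>\<^bsub>S\<^esub> x, x) \<in> \<rho> \<and> (x \<otimes>\<^bsub>S\<^esub> \<one>\<^bsub>S\<^esub>, x) \<in> \<rho>)"
    unfolding monoid_def by (simp add: inv_quot_simps[OF \<rho>] img cl) blast
  moreover have "inverse_monoid_axioms (inv_quot S \<rho>) \<longleftrightarrow>
     (\<forall>x\<in>carrier S. (x \<otimes>\<^bsub>S\<^esub> x\<^sup>\<dagger>\<^bsub>S\<^esub> \<otimes>\<^bsub>S\<^esub> x, x) \<in> \<rho> \<and> (x\<^sup>\<dagger>\<^bsub>S\<^esub> \<otimes>\<^bsub>S\<^esub> x \<otimes>\<^bsub>S\<^esub> x\<^sup>\<dagger>\<^bsub>S\<^esub>, x\<^sup>\<dagger>\<^bsub>S\<^esub>) \<in> \<rho>) \<and>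
     (\<forall>x\<in>carrier S. \<forall>y\<in>carrier S. (x \<otimes>\<^bsub>S\<^esub> y \<otimes>\<^bsub>S\<^esub> x, x) \<in> \<rho> \<longrightarrow> (y \<otimes>\<^bsub>S\<^esub> x \<otimes>\<^bsub>S\<^esub> y, y) \<in> \<rho> \<longrightarrow>
        (y, x\<^sup>\<dagger>\<^bsub>S\<^esub>) \<in> \<rho>)"
    unfolding inverse_monoid_axioms_def by (simp add: inv_quot_simps[OF \<rho>] img cl) blast
  ultimately show ?thesis unfolding inverse_monoid_def inv_axioms_mod_def by blast
qed

lemma inv_cong_gen_props:
  assumes S: "inv_closed S" and Rel: "Rel \<subseteq> carrier S \<times> carrier S"
  shows "inv_congruence S (inv_cong_gen S Rel)"
    and "inverse_monoid (inv_quot S (inv_cong_gen S Rel))"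
    and "Rel \<subseteq> inv_cong_gen S Rel"
proof -
  define \<C> where "\<C> = {\<rho>. inv_congruence S \<rho> \<and> inv_axioms_mod S \<rho> \<and> Rel \<subseteq> \<rho>}"
  have gen: "inv_cong_gen S Rel = \<Inter>\<C>"
    unfolding inv_cong_gen_def \<C>_def using inverse_monoid_quot_iff[OF _ S] by metis
  have "inv_congruence S (carrier S \<times> carrier S)"
    using S unfolding inv_congruence_def inv_closed_def
    by (auto simp: equiv_def refl_on_def sym_def trans_def)
  moreover have "inv_axioms_mod S (carrier S \<times> carrier S)"
    using S unfolding inv_axioms_mod_def inv_closed_def by auto
  \<comment> \<open>The full relation belongs to the family, so the intersection is a relation on
    the carrier.\<close>
  ultimately have top: "carrier S \<times> carrier S \<in> \<C>" using Rel by (simp add: \<C>_def)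
  show c: "inv_congruence S (inv_cong_gen S Rel)"
    unfolding inv_congruence_def
  proof (intro conjI)
    have eq: "equiv (carrier S) \<rho>" if "\<rho> \<in> \<C>" for \<rho>
      using that by (simp add: \<C>_def inv_congruence_def)
    have "\<Inter>\<C> \<subseteq> carrier S \<times> carrier S" using top by blast
    moreover have "refl_on (carrier S) (\<Inter>\<C>)"
      using eq by (auto simp: equiv_def refl_on_def)
    moreover have "sym (\<Inter>\<C>)" using eq by (meson InterE InterI equiv_def sym_def)
    moreover have "trans (\<Inter>\<C>)" using eq by (meson InterE InterI equiv_def trans_def)
    ultimately show "equiv (carrier S) (inv_cong_gen S Rel)"
      unfolding gen by (rule equivI)
  qed (auto simp: gen \<C>_def inv_congruence_def)
  show "Rel \<subseteq> inv_cong_gen S Rel" by (auto simp: gen \<C>_def)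
  have "inv_axioms_mod S \<rho>" if "\<rho> \<in> \<C>" for \<rho> using that by (simp add: \<C>_def)
  then have "inv_axioms_mod S (\<Inter>\<C>)"
    unfolding inv_axioms_mod_def by (intro conjI ballI impI InterI) (meson InterD)+
  then show "inverse_monoid (inv_quot S (inv_cong_gen S Rel))"
    unfolding inverse_monoid_quot_iff[OF c S] by (simp add: gen)
qed

lemma inv_quot_hom:
  assumes "inv_congruence S \<rho>"
  shows "(\<lambda>x. \<rho> `` {x}) \<in> hom S (inv_quot S \<rho>)"
  using assms by (auto simp: hom_def inv_quot_simps)

text \<open>S is only closed under the operations, so that terms and free inverse monoids are both
  covered. The axioms modulo the kernel of k are therefore inherited from T, and preservation of
  inverses is a premise.\<close>

lemma inv_quot_gen_universal:
  assumes S: "inv_closed S" and T: "inverse_monoid T"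
    and k: "k \<in> hom S T" and k1: "k \<one>\<^bsub>S\<^esub> = \<one>\<^bsub>T\<^esub>"
    and kinv: "\<And>x. x \<in> carrier S \<Longrightarrow> k (x\<^sup>\<dagger>\<^bsub>S\<^esub>) = (k x)\<^sup>\<dagger>\<^bsub>T\<^esub>"
    and Rel: "Rel \<subseteq> carrier S \<times> carrier S" and ker: "\<forall>(x, y) \<in> Rel. k x = k y"
  shows "\<exists>h \<in> hom (inv_quot S (inv_cong_gen S Rel)) T.
    h \<one>\<^bsub>inv_quot S (inv_cong_gen S Rel)\<^esub> = \<one>\<^bsub>T\<^esub> \<and>
    (\<forall>x\<in>carrier S. h (inv_cong_gen S Rel `` {x}) = k x)"
proof -
  interpret T: inverse_monoid T by (rule T)
  have km: "k (x \<otimes>\<^bsub>S\<^esub> y) = k x \<otimes>\<^bsub>T\<^esub> k y" if "x \<in> carrier S" "y \<in> carrier S" for x y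
    using k that by (simp add: hom_def)
  have kc: "k x \<in> carrier T" if "x \<in> carrier S" for x
    using k that by (auto simp: hom_def)
  have cl: "\<one>\<^bsub>S\<^esub> \<in> carrier S" "\<And>x y. x \<in> carrier S \<Longrightarrow> y \<in> carrier S \<Longrightarrow> x \<otimes>\<^bsub>S\<^esub> y \<in> carrier S"
    "\<And>x. x \<in> carrier S \<Longrightarrow> x\<^sup>\<dagger>\<^bsub>S\<^esub> \<in> carrier S"
    using S by (simp_all add: inv_closed_def)
  define \<kappa> where "\<kappa> = {(x, y). x \<in> carrier S \<and> y \<in> carrier S \<and> k x = k y}"
  define \<rho> where "\<rho> = inv_cong_gen S Rel"
  have c: "inv_congruence S \<kappa>"
    unfolding inv_congruence_def \<kappa>_def
    by (auto simp: km kinv cl equiv_def refl_on_def sym_def trans_def)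
  have "inv_axioms_mod S \<kappa>"
    unfolding inv_axioms_mod_def \<kappa>_def
    by (auto simp: km kc k1 kinv cl T.ginv_regular T.ginv_regular' T.m_assoc[OF kc kc kc]
        intro: T.ginv_unique)
  then have "inverse_monoid (inv_quot S \<kappa>)"
    using inverse_monoid_quot_iff[OF c S] by blast
  with c Rel ker have \<rho>\<kappa>: "\<rho> \<subseteq> \<kappa>"
    unfolding inv_cong_gen_def \<kappa>_def \<rho>_def by blast
  have \<rho>: "inv_congruence S \<rho>"
    unfolding \<rho>_def by (rule inv_cong_gen_props[OF S Rel])
  then have eq: "equiv (carrier S) \<rho>" by (simp add: inv_congruence_def)
  define h where "h c = k (SOME x. x \<in> c)" for c
  have h: "h (\<rho> `` {x}) = k x" if "x \<in> carrier S" for x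
  proof -
    have "x \<in> \<rho> `` {x}" using equiv_class_self[OF eq that] .
    then have "(SOME y. y \<in> \<rho> `` {x}) \<in> \<rho> `` {x}" by (rule someI)
    then show ?thesis unfolding h_def using \<rho>\<kappa> by (auto simp: \<kappa>_def)
  qed
  have "h \<in> hom (inv_quot S \<rho>) T" "h \<one>\<^bsub>inv_quot S \<rho>\<^esub> = \<one>\<^bsub>T\<^esub>"
    unfolding hom_def by (auto simp: inv_quot_simps[OF \<rho>] h km kc k1 cl)
  then show ?thesis using h by (auto simp: \<rho>_def)
qed

lemma inv_closed_iterm_algebra: "inv_closed (iterm_algebra A)"
  by (auto simp: inv_closed_def iterm_algebra_def)

lemmas FI_cong_props = inv_cong_gen_props[OF inv_closed_iterm_algebra empty_subsetI]

lemma inverse_monoid_FI: "inverse_monoid (FI A)"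
  unfolding FI_def by (rule FI_cong_props(2))

abbreviation FI_class :: "'a set \<Rightarrow> 'a iterm \<Rightarrow> 'a iterm set" where
  "FI_class A t \<equiv> inv_cong_gen (iterm_algebra A) {} `` {t}"

lemma FI_simps:
  "set_iterm s \<subseteq> A \<Longrightarrow> set_iterm t \<subseteq> A \<Longrightarrow> FI_class A s \<otimes>\<^bsub>FI A\<^esub> FI_class A t = FI_class A (IMult s t)"
  "\<one>\<^bsub>FI A\<^esub> = FI_class A IOne"
  "set_iterm t \<subseteq> A \<Longrightarrow> (FI_class A t)\<^sup>\<dagger>\<^bsub>FI A\<^esub> = FI_class A (IInv t)"
  "carrier (FI A) = FI_class A ` {t. set_iterm t \<subseteq> A}"
  using inv_quot_simps[OF FI_cong_props(1)[of A]]
  by (auto simp: FI_def iterm_algebra_def)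

lemma FI_gen_Pi: "FI_gen A \<in> A \<rightarrow> carrier (FI A)"
  by (auto simp: FI_gen_def FI_simps)

primrec iterm_eval :: "('s, 'd) inv_monoid_scheme \<Rightarrow> ('a \<Rightarrow> 's) \<Rightarrow> 'a iterm \<Rightarrow> 's" where
  "iterm_eval S g (IGen a) = g a"
| "iterm_eval S g IOne = \<one>\<^bsub>S\<^esub>"
| "iterm_eval S g (IMult s t) = iterm_eval S g s \<otimes>\<^bsub>S\<^esub> iterm_eval S g t"
| "iterm_eval S g (IInv t) = (iterm_eval S g t)\<^sup>\<dagger>\<^bsub>S\<^esub>"

lemma FI_universal:
  assumes T: "inverse_monoid T" and g: "g \<in> A \<rightarrow> carrier T"
  shows "\<exists>h \<in> hom (FI A) T. h \<one>\<^bsub>FI A\<^esub> = \<one>\<^bsub>T\<^esub> \<and> (\<forall>a\<in>A. h (FI_gen A a) = g a)"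
proof -
  interpret T: inverse_monoid T by (rule T)
  have ev: "iterm_eval T g t \<in> carrier T" if "set_iterm t \<subseteq> A" for t
    using that g by (induction t) (auto intro: T.ginv_closed)
  have "\<exists>h \<in> hom (FI A) T. h \<one>\<^bsub>FI A\<^esub> = \<one>\<^bsub>T\<^esub> \<and>
      (\<forall>t\<in>carrier (iterm_algebra A). h (FI_class A t) = iterm_eval T g t)"
    unfolding FI_def
  proof (rule inv_quot_gen_universal[OF inv_closed_iterm_algebra T])
    show "iterm_eval T g \<in> hom (iterm_algebra A) T"
      using ev by (auto simp: hom_def iterm_algebra_def)
  qed (auto simp: iterm_algebra_def)
  then show ?thesis by (fastforce simp: FI_gen_def iterm_algebra_def)
qed

lemma FI_generated:
  assumes "FI_gen A ` A \<subseteq> K" "\<one>\<^bsub>FI A\<^esub> \<in> K"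
    and mult: "\<And>x y. x \<in> K \<Longrightarrow> y \<in> K \<Longrightarrow> x \<otimes>\<^bsub>FI A\<^esub> y \<in> K" and inv: "\<And>x. x \<in> K \<Longrightarrow> x\<^sup>\<dagger>\<^bsub>FI A\<^esub> \<in> K"
  shows "carrier (FI A) \<subseteq> K"
proof -
  have "FI_class A t \<in> K" if "set_iterm t \<subseteq> A" for t
    using that
  proof (induction t)
    case (IGen a)
    then have "FI_gen A a \<in> K" using assms(1) by auto
    then show ?case by (simp add: FI_gen_def)
  next
    case (IMult s t)
    then show ?case using mult[of "FI_class A s" "FI_class A t"] by (simp add: FI_simps)
  next
    case (IInv t)
    then show ?case using inv[of "FI_class A t"] by (simp add: FI_simps)
  qed (use assms(2) in \<open>simp add: FI_simps\<close>)
  then show ?thesis by (auto simp: FI_simps)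
qed

section \<open>The presented inverse monoid \<open>FIR\<close>\<close>

context
  fixes M :: "('m, 'c) monoid_scheme" and X :: "'x set" and R :: "'x identity set"
  assumes M: "monoid M" and R: "R \<subseteq> identities X"
begin

lemma restriction_monoid_FI: "restriction_monoid (restr_of_inv (FI A))"
  by (rule inverse_monoid.restriction_monoid_restr_of_inv[OF inverse_monoid_FI])

lemma FI_gen_restr_Pi: "FI_gen A \<in> A \<rightarrow> carrier (restr_of_inv (FI A))"
  using FI_gen_Pi by (simp add: restr_of_inv_def)

lemma FIR_rel_closed:
  "premorphism_rel M (restr_of_inv (FI (carrier M))) (FI_gen (carrier M)) \<union>
   identity_rel X R M (restr_of_inv (FI (carrier M))) (FI_gen (carrier M))
   \<subseteq> carrier (FI (carrier M)) \<times> carrier (FI (carrier M))"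
  using presentation_rel_closed[OF M restriction_monoid_FI R FI_gen_restr_Pi]
  by (simp add: restr_of_inv_def)

lemmas FIR_cong_props =
  inv_cong_gen_props[OF inverse_monoid_closed[OF inverse_monoid_FI] FIR_rel_closed,
    folded FIR_cong_def[of X R M, unfolded Let_def], folded FIR_def]

lemma inverse_monoid_FIR: "inverse_monoid (FIR X R M)"
  by (rule FIR_cong_props)

lemma restriction_monoid_FIR: "restriction_monoid (restr_of_inv (FIR X R M))"
  by (rule inverse_monoid.restriction_monoid_restr_of_inv[OF inverse_monoid_FIR])

lemma FIR_proj_hom: "(\<lambda>x. FIR_cong X R M `` {x}) \<in> hom (FI (carrier M)) (FIR X R M)"
  unfolding FIR_def by (rule inv_quot_hom[OF FIR_cong_props(1)])

lemma FIR_proj_one: "FIR_cong X R M `` {\<one>\<^bsub>FI (carrier M)\<^esub>} = \<one>\<^bsub>FIR X R M\<^esub>"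
  unfolding FIR_def by (rule inv_quot_simps(2)[OF FIR_cong_props(1), symmetric])

lemma R_premorphism_FIR_gen: "R_premorphism X R M (restr_of_inv (FIR X R M)) (FIR_gen X R M)"
proof -
  have "equiv (carrier (FI (carrier M))) (FIR_cong X R M)"
    using FIR_cong_props(1) by (simp add: inv_congruence_def)
  then show ?thesis
    unfolding FIR_gen_def R_premorphism_iff_kernel[OF M restriction_monoid_FI restriction_monoid_FIR R
        restr_hom_restr_of_inv[OF inverse_monoid_FI inverse_monoid_FIR FIR_proj_hom FIR_proj_one]
        FI_gen_restr_Pi]
    using FIR_cong_props(3) by (auto dest: equiv_class_eq)
qed

lemma FIR_universal:
  assumes T: "inverse_monoid T" and \<gamma>: "R_premorphism X R M (restr_of_inv T) \<gamma>"
  shows "\<exists>h \<in> restr_hom (restr_of_inv (FIR X R M)) (restr_of_inv T).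
    \<forall>m\<in>carrier M. h (FIR_gen X R M m) = \<gamma> m"
proof -
  let ?F = "FI (carrier M)"
  have T': "restriction_monoid (restr_of_inv T)"
    by (rule inverse_monoid.restriction_monoid_restr_of_inv[OF T])
  have "\<gamma> \<in> carrier M \<rightarrow> carrier T" using \<gamma> by (simp add: R_premorphism_def restr_of_inv_def)
  from FI_universal[OF T this] obtain k where k: "k \<in> hom ?F T" "k \<one>\<^bsub>?F\<^esub> = \<one>\<^bsub>T\<^esub>"
    and kg: "\<And>m. m \<in> carrier M \<Longrightarrow> k (FI_gen (carrier M) m) = \<gamma> m" by blast
  note k' = restr_hom_restr_of_inv[OF inverse_monoid_FI T k]
  have "R_premorphism X R M (restr_of_inv T) (\<lambda>m. k (FI_gen (carrier M) m))"
    using R_premorphism_cong[OF M kg T' R \<gamma>] .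
  then have "\<forall>(x, y) \<in> premorphism_rel M (restr_of_inv ?F) (FI_gen (carrier M)) \<union>
      identity_rel X R M (restr_of_inv ?F) (FI_gen (carrier M)). k x = k y"
    by (simp only: R_premorphism_iff_kernel[OF M restriction_monoid_FI T' R k' FI_gen_restr_Pi])
  from inv_quot_gen_universal[OF inverse_monoid_closed[OF inverse_monoid_FI] T k
      hom_ginv[OF inverse_monoid_FI T k(1)] FIR_rel_closed this]
  obtain h where "h \<in> hom (FIR X R M) T" "h \<one>\<^bsub>FIR X R M\<^esub> = \<one>\<^bsub>T\<^esub>"
    and h: "\<And>x. x \<in> carrier ?F \<Longrightarrow> h (FIR_cong X R M `` {x}) = k x"
    unfolding FIR_def FIR_cong_def Let_def by blast
  then have "h \<in> restr_hom (restr_of_inv (FIR X R M)) (restr_of_inv T)"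
    by (intro restr_hom_restr_of_inv inverse_monoid_FIR T)
  moreover have "h (FIR_gen X R M m) = \<gamma> m" if "m \<in> carrier M" for m
    using that FI_gen_Pi[of "carrier M"] by (simp add: FIR_gen_def h kg Pi_iff)
  ultimately show ?thesis by blast
qed

lemma FIR_generated:
  assumes K: "FIR_gen X R M ` carrier M \<subseteq> K" and one: "\<one>\<^bsub>FIR X R M\<^esub> \<in> K"
    and mult: "\<And>x y. x \<in> K \<Longrightarrow> y \<in> K \<Longrightarrow> x \<otimes>\<^bsub>FIR X R M\<^esub> y \<in> K"
    and inv: "\<And>x. x \<in> K \<Longrightarrow> x\<^sup>\<dagger>\<^bsub>FIR X R M\<^esub> \<in> K"
  shows "carrier (FIR X R M) \<subseteq> K"
proof -
  let ?F = "FI (carrier M)"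
  let ?\<pi> = "\<lambda>x. FIR_cong X R M `` {x}"
  interpret F: inverse_monoid ?F by (rule inverse_monoid_FI)
  have pm: "?\<pi> (x \<otimes>\<^bsub>?F\<^esub> y) = ?\<pi> x \<otimes>\<^bsub>FIR X R M\<^esub> ?\<pi> y" if "x \<in> carrier ?F" "y \<in> carrier ?F" for x y
    using FIR_proj_hom that by (simp add: hom_def)
  note pinv = hom_ginv[OF inverse_monoid_FI inverse_monoid_FIR FIR_proj_hom]
  have "carrier ?F \<subseteq> {x \<in> carrier ?F. ?\<pi> x \<in> K}"
  proof (rule FI_generated)
    show "FI_gen (carrier M) ` carrier M \<subseteq> {x \<in> carrier ?F. ?\<pi> x \<in> K}"
      using K FI_gen_Pi[of "carrier M"] by (auto simp: FIR_gen_def)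
  qed (auto simp: FIR_proj_one one pm pinv mult inv F.ginv_closed)
  then show ?thesis
    using inv_quot_simps(4)[OF FIR_cong_props(1)] unfolding FIR_def by auto
qed

end

section \<open>The isomorphism\<close>

lemma projection_multiples_restriction_submonoid:
  fixes S (structure)
  assumes M: "monoid M" and S: "restriction_monoid S" and \<gamma>: "R_premorphism X R M S \<gamma>"
  shows "restriction_submonoid {e \<otimes> \<gamma> m | e m. e \<in> projections S \<and> m \<in> carrier M} S"
    (is "restriction_submonoid ?T S")
proof -
  interpret S: restriction_monoid S by (rule S)
  interpret M: monoid M by (rule M)
  have \<gamma>c [simp]: "\<gamma> m \<in> carrier S" if "m \<in> carrier M" for m
    using \<gamma> that by (auto simp: R_premorphism_def)
  have \<gamma>1: "\<gamma> \<one>\<^bsub>M\<^esub> = \<one>" using \<gamma> by (simp add: R_premorphism_def)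
  note [simp] = S.projections_closed
  have P: "e \<in> ?T" if "e \<in> projections S" for e
    using that \<gamma>1 by (intro CollectI exI[of _ e] exI[of _ "\<one>\<^bsub>M\<^esub>"]) simp
  show ?thesis
  proof
    show sub: "?T \<subseteq> carrier S" by auto
    show "\<one> \<in> ?T" by (rule P[OF S.one_projection])
    show "x\<^sup>\<star> \<in> ?T" "x\<^sup>\<oplus> \<in> ?T" if "x \<in> ?T" for x
      using P[OF S.star_projection] P[OF S.plus_projection] sub that by blast+
    show "x \<otimes> y \<in> ?T" if xy: "x \<in> ?T" "y \<in> ?T" for x y
    proof -
      obtain e m f n where x: "x = e \<otimes> \<gamma> m" and y: "y = f \<otimes> \<gamma> n"
        and [simp]: "e \<in> projections S" "f \<in> projections S" "m \<in> carrier M" "n \<in> carrier M"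
        using xy by blast
      define p where "p = (\<gamma> m \<otimes> f)\<^sup>\<oplus>"
      define q where "q = (\<gamma> (m \<otimes>\<^bsub>M\<^esub> n) \<otimes> (\<gamma> m \<otimes> \<gamma> n)\<^sup>\<star>)\<^sup>\<oplus>"
      have [simp]: "p \<in> projections S" "q \<in> projections S"
        by (simp_all add: p_def q_def S.plus_projection S.star_closed)
      have 1: "\<gamma> m \<otimes> f = p \<otimes> \<gamma> m" unfolding p_def by (rule S.mult_projection) simp_all
      have "\<gamma> m \<otimes> \<gamma> n = \<gamma> (m \<otimes>\<^bsub>M\<^esub> n) \<otimes> (\<gamma> m \<otimes> \<gamma> n)\<^sup>\<star>"
        using \<gamma> by (simp add: R_premorphism_def)
      also have "\<dots> = q \<otimes> \<gamma> (m \<otimes>\<^bsub>M\<^esub> n)"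
        unfolding q_def by (rule S.mult_projection) (simp_all add: S.star_projection)
      finally have 2: "\<gamma> m \<otimes> \<gamma> n = q \<otimes> \<gamma> (m \<otimes>\<^bsub>M\<^esub> n)" .
      have "x \<otimes> y = e \<otimes> (\<gamma> m \<otimes> f) \<otimes> \<gamma> n" by (simp add: x y S.m_assoc)
      also have "\<dots> = e \<otimes> p \<otimes> (\<gamma> m \<otimes> \<gamma> n)" by (simp add: 1 S.m_assoc)
      also have "\<dots> = e \<otimes> p \<otimes> q \<otimes> \<gamma> (m \<otimes>\<^bsub>M\<^esub> n)" by (simp add: 2 S.m_assoc)
      finally show ?thesis
        by (intro CollectI exI[of _ "e \<otimes> p \<otimes> q"] exI[of _ "m \<otimes>\<^bsub>M\<^esub> n"]) (simp add: S.projections_mult)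
    qed
  qed
qed

lemma R_premorphism_compose:
  assumes M: "monoid M" and S: "restriction_monoid S" and T: "restriction_monoid T"
    and R: "R \<subseteq> identities X"
    and k: "k \<in> restr_hom S T" and \<iota>: "R_premorphism X R M S \<iota>"
  shows "R_premorphism X R M T (\<lambda>m. k (\<iota> m))"
proof -
  have \<iota>c: "\<iota> \<in> carrier M \<rightarrow> carrier S" using \<iota> by (simp add: R_premorphism_def)
  have id: "(\<lambda>x. x) \<in> restr_hom S S" by (auto simp: restr_hom_def hom_def)
  \<comment> \<open>The kernel criterion for the identity of S says that the defining relations are
    equalities in S; any morphism preserves these.\<close>
  have eq: "\<forall>(x, y) \<in> premorphism_rel M S \<iota> \<union> identity_rel X R M S \<iota>. x = y"
    using \<iota> by (simp add: R_premorphism_iff_kernel[OF M S S R id \<iota>c, symmetric])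
  show ?thesis
    unfolding R_premorphism_iff_kernel[OF M S T R k \<iota>c]
  proof (rule ballI, rule case_prodI2)
    fix p x y assume "p \<in> premorphism_rel M S \<iota> \<union> identity_rel X R M S \<iota>" "p = (x, y)"
    then have "x = y" using bspec[OF eq, of p] by (simp del: Un_iff)
    then show "k x = k y" by simp
  qed
qed

text \<open>All projections of a group are trivial, so the premorphism law is multiplicativity. The
  identities hold because \<open>\<epsilon>\<close> is a monoid morphism, preserving the identity by
  cancellation, and the members of R are admissible.\<close>

lemma R_premorphism_group:
  assumes M: "monoid M" and G: "group G" and \<epsilon>: "\<epsilon> \<in> hom M G"
    and R: "R \<subseteq> identities X" and adm: "\<And>p q. (p, q) \<in> R \<Longrightarrow> admissible X (p, q)"
  shows "R_premorphism X R M (restr_of_inv (inv_of_group G)) \<epsilon>"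
proof -
  interpret M: monoid M by (rule M)
  interpret G: group G by (rule G)
  have c: "\<epsilon> m \<in> carrier G" if "m \<in> carrier M" for m using \<epsilon> that by (auto simp: hom_def)
  have m: "\<epsilon> (m \<otimes>\<^bsub>M\<^esub> n) = \<epsilon> m \<otimes>\<^bsub>G\<^esub> \<epsilon> n" if "m \<in> carrier M" "n \<in> carrier M" for m n
    using \<epsilon> that by (simp add: hom_def)
  have one: "\<epsilon> \<one>\<^bsub>M\<^esub> = \<one>\<^bsub>G\<^esub>"
    using m[of "\<one>\<^bsub>M\<^esub>" "\<one>\<^bsub>M\<^esub>"] c[of "\<one>\<^bsub>M\<^esub>"] by (simp add: G.r_cancel_one)
  have "satisfies X M (restr_of_inv (inv_of_group G)) \<epsilon> pq" if "pq \<in> R" for pq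
  proof (rule admissible_satisfies[OF _ _ M])
    show "admissible X pq" "pq \<in> identities X" using adm[of "fst pq" "snd pq"] R that by auto
    show "restriction_monoid (restr_of_inv (inv_of_group G))"
      by (rule inverse_monoid.restriction_monoid_restr_of_inv[OF inverse_monoid_inv_of_group[OF G]])
  qed (use \<epsilon> one in \<open>simp_all add: restr_of_inv_def inv_of_group_def hom_def\<close>)
  then show ?thesis
    by (auto simp: R_premorphism_def restr_of_inv_def inv_of_group_def c m one)
qed

theorem theorem8p3:
  fixes M :: "('m, 'c) monoid_scheme" and G :: "('g, 'd) monoid_scheme"
    and X :: "'x set" and R :: "'x identity set"
  assumes "monoid M"
    and "group G" and "\<epsilon> \<in> hom M G" and "inj_on \<epsilon> (carrier M)"
    and "R \<subseteq> identities X" and "\<And>p q. (p, q) \<in> R \<Longrightarrow> admissible X (p, q)"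
  shows "let I = FIR X R M;
             S = restr_of_inv I;
             gens = FIR_gen X R M ` carrier M;
             T = {e \<otimes>\<^bsub>I\<^esub> FIR_gen X R M m | e m. e \<in> idempotents I \<and> m \<in> carrier M}
         in restriction_submonoid T S \<and>
            restr_isomorphic (FRR X R M) (S\<lparr>carrier := T\<rparr>) \<and>
            T = restr_generated S gens \<and>
            T = monoid_generated S (idempotents I \<union> gens)"
proof -
  note M = assms(1) and R = assms(5)
  define I where "I = FIR X R M"
  define S where "S = restr_of_inv I"
  define F where "F = FRR X R M"
  define \<iota> where "\<iota> = FIR_gen X R M"
  define \<beta> where "\<beta> = FRR_gen X R M"
  define T where "T = {e \<otimes>\<^bsub>I\<^esub> \<iota> m | e m. e \<in> idempotents I \<and> m \<in> carrier M}"
  interpret M: monoid M by (rule M)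
  interpret I: inverse_monoid I unfolding I_def by (rule inverse_monoid_FIR[OF M R])
  interpret S: restriction_monoid S unfolding S_def by (rule I.restriction_monoid_restr_of_inv)
  interpret F: restriction_monoid F unfolding F_def by (rule restriction_monoid_FRR[OF M R])
  note S_simps = I.restr_of_inv_simps[folded S_def]
  have S: "restriction_monoid S" and F: "restriction_monoid F" by unfold_locales
  have pS: "projections S = idempotents I" unfolding S_def by (rule I.projections_restr_of_inv)
  have \<iota>: "R_premorphism X R M S \<iota>"
    unfolding S_def I_def \<iota>_def by (rule R_premorphism_FIR_gen[OF M R])
  have \<iota>c: "\<iota> m \<in> carrier I" if "m \<in> carrier M" for m
    using \<iota> that by (auto simp: R_premorphism_def S_simps)
  have \<iota>1: "\<iota> \<one>\<^bsub>M\<^esub> = \<one>\<^bsub>I\<^esub>" using \<iota> by (simp add: R_premorphism_def S_simps)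
  have \<beta>: "R_premorphism X R M F \<beta>"
    unfolding F_def \<beta>_def by (rule R_premorphism_FRR_gen[OF M R])
  have \<beta>c: "\<beta> m \<in> carrier F" if "m \<in> carrier M" for m
    using \<beta> that by (auto simp: R_premorphism_def)
  have T: "restriction_submonoid T S"
    using projection_multiples_restriction_submonoid[OF M S \<iota>] by (simp add: T_def pS S_simps)
  interpret T: restriction_submonoid T S by (rule T)
  have gens_T: "\<iota> ` carrier M \<subseteq> T"
  proof
    fix x assume "x \<in> \<iota> ` carrier M"
    then obtain m where "m \<in> carrier M" "x = \<one>\<^bsub>I\<^esub> \<otimes>\<^bsub>I\<^esub> \<iota> m" using \<iota>c by auto
    moreover have "\<one>\<^bsub>I\<^esub> \<in> idempotents I" by (simp add: idempotents_def)
    ultimately show "x \<in> T" unfolding T_def by blast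
  qed
  have idem_T: "idempotents I \<subseteq> T"
  proof
    fix e assume e: "e \<in> idempotents I"
    then have "e = e \<otimes>\<^bsub>I\<^esub> \<iota> \<one>\<^bsub>M\<^esub>" using I.idempotentsD(1) by (simp add: \<iota>1)
    then show "e \<in> T" unfolding T_def using e by blast
  qed
  have T_least: "T \<subseteq> H" if "submonoid H S" "idempotents I \<subseteq> H" "\<iota> ` carrier M \<subseteq> H" for H
  proof
    fix x assume "x \<in> T"
    then obtain e m where "e \<in> idempotents I" "m \<in> carrier M" "x = e \<otimes>\<^bsub>S\<^esub> \<iota> m"
      by (auto simp: T_def S_simps)
    moreover from this have "e \<in> H" "\<iota> m \<in> H"
      using \<open>idempotents I \<subseteq> H\<close> \<open>\<iota> ` carrier M \<subseteq> H\<close> by auto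
    ultimately show "x \<in> H" using submonoid.m_closed[OF \<open>submonoid H S\<close>] by simp
  qed
  have T_least': "T \<subseteq> H" if H: "restriction_submonoid H S" and gH: "\<iota> ` carrier M \<subseteq> H" for H
  proof -
    have "idempotents I \<subseteq> H"
    proof (rule I.idempotents_subset_restriction_submonoid)
      show "carrier I \<subseteq> K" if "\<iota> ` carrier M \<subseteq> K" "\<one>\<^bsub>I\<^esub> \<in> K"
        "\<And>x y. x \<in> K \<Longrightarrow> y \<in> K \<Longrightarrow> x \<otimes>\<^bsub>I\<^esub> y \<in> K" "\<And>x. x \<in> K \<Longrightarrow> x\<^sup>\<dagger>\<^bsub>I\<^esub> \<in> K" for K
        using that unfolding I_def \<iota>_def by (rule FIR_generated[OF M R])
    qed (use H gH \<iota>c in \<open>auto simp: S_def\<close>)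
    then show ?thesis using T_least[OF restriction_submonoid.axioms(1)[OF H]] gH by blast
  qed
  have T_restr: "T = restr_generated S (\<iota> ` carrier M)"
    unfolding restr_generated_def using T gens_T T_least' by blast
  have T_mon: "T = monoid_generated S (idempotents I \<union> \<iota> ` carrier M)"
    unfolding monoid_generated_def using T.submonoid_axioms gens_T idem_T T_least by blast

  \<comment> \<open>The isomorphism is the morphism induced by viewing \<open>\<iota>\<close> as an
    R-premorphism into the reduct of I.\<close>
  obtain h where h: "h \<in> restr_hom F S" and h\<beta>: "\<And>m. m \<in> carrier M \<Longrightarrow> h (\<beta> m) = \<iota> m"
    using FRR_universal[OF M R S \<iota>] unfolding F_def \<beta>_def by blast
  note hD = restr_homD[OF h]
  have F_dec: "\<exists>m\<in>carrier M. a = a\<^sup>\<oplus>\<^bsub>F\<^esub> \<otimes>\<^bsub>F\<^esub> \<beta> m" if a: "a \<in> carrier F" for a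
  proof -
    let ?T = "{e \<otimes>\<^bsub>F\<^esub> \<beta> m | e m. e \<in> projections F \<and> m \<in> carrier M}"
    have "\<beta> ` carrier M \<subseteq> ?T"
    proof
      fix x assume "x \<in> \<beta> ` carrier M"
      then obtain m where "m \<in> carrier M" "x = \<one>\<^bsub>F\<^esub> \<otimes>\<^bsub>F\<^esub> \<beta> m" using \<beta>c by auto
      then show "x \<in> ?T" using F.one_projection by blast
    qed
    then have "carrier F \<subseteq> ?T"
      using projection_multiples_restriction_submonoid[OF M F \<beta>] unfolding F_def \<beta>_def
      by (rule FRR_generated[OF M R])
    then obtain e m where e: "e \<in> projections F" and m: "m \<in> carrier M" and a: "a = e \<otimes>\<^bsub>F\<^esub> \<beta> m"
      using a by blast
    have "a\<^sup>\<oplus>\<^bsub>F\<^esub> \<otimes>\<^bsub>F\<^esub> \<beta> m = a"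
      using F.plus_projection_left[OF e \<beta>c[OF m]] F.plus_left[OF \<beta>c[OF m]] \<beta>c[OF m]
        F.projections_closed[OF e] by (simp add: a F.m_assoc F.plus_closed)
    then show ?thesis using m by force
  qed
  \<comment> \<open>One inclusion comes from \<open>F_dec\<close>. For the other, the image is a
    restriction submonoid containing the generators, and T is the least of these.\<close>
  have h_image: "h ` carrier F = T"
  proof
    show "h ` carrier F \<subseteq> T"
    proof
      fix x assume "x \<in> h ` carrier F"
      then obtain a m where a: "a \<in> carrier F" and m: "m \<in> carrier M"
        and x: "x = h (a\<^sup>\<oplus>\<^bsub>F\<^esub> \<otimes>\<^bsub>F\<^esub> \<beta> m)" using F_dec by fastforce
      have "x = (h a)\<^sup>\<oplus>\<^bsub>S\<^esub> \<otimes>\<^bsub>I\<^esub> \<iota> m"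
        using a m \<beta>c by (simp add: x hD F.plus_closed h\<beta> S_simps(2))
      moreover have "(h a)\<^sup>\<oplus>\<^bsub>S\<^esub> \<in> idempotents I"
        using S.plus_projection[OF hD(1)[OF a]] by (simp add: pS)
      ultimately show "x \<in> T" unfolding T_def using m by blast
    qed
    have "\<iota> ` carrier M \<subseteq> h ` carrier F" using h\<beta> \<beta>c by force
    then show "T \<subseteq> h ` carrier F" by (rule T_least'[OF restr_hom_image[OF F h]])
  qed
  \<comment> \<open>Composing \<open>\<beta>\<close> with \<open>munn F\<close> gives an
    R-premorphism into an inverse monoid, which extends to a morphism k on
    \<open>FIR\<close>.\<close>
  have h_inj_proj: "p = q" if p: "p \<in> projections F" and q: "q \<in> projections F" and eq: "h p = h q" for p q
  proof -
    let ?J = "sym_inv_monoid (projections F)"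
    have J: "inverse_monoid ?J" by (rule inverse_monoid_sym_inv_monoid)
    have J': "restriction_monoid (restr_of_inv ?J)"
      by (rule inverse_monoid.restriction_monoid_restr_of_inv[OF J])
    from FIR_universal[OF M R J R_premorphism_compose[OF M F J' R F.munn_hom \<beta>]]
    obtain k where k: "k \<in> restr_hom S (restr_of_inv ?J)"
      and k\<iota>: "\<And>m. m \<in> carrier M \<Longrightarrow> k (\<iota> m) = munn F (\<beta> m)"
      unfolding S_def I_def \<iota>_def by blast
    note kD = restr_homD[OF k] and mD = restr_homD[OF F.munn_hom]
    \<comment> \<open>The equalizer of \<open>k \<circ> h\<close> and \<open>munn F\<close> is a
      restriction submonoid containing the generators, hence all of F. Thus h identifies only
      projections that \<open>munn F\<close> identifies.\<close>
    let ?E = "{a \<in> carrier F. k (h a) = munn F a}"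
    have "carrier F \<subseteq> ?E"
    proof (rule FRR_generated[OF M R, folded F_def \<beta>_def])
      show "\<beta> ` carrier M \<subseteq> ?E" using \<beta>c h\<beta> k\<iota> by auto
      show "restriction_submonoid ?E F"
        by unfold_locales (auto simp: hD kD mD F.star_closed F.plus_closed)
    qed
    then have "munn F p = munn F q"
      using eq F.projections_closed[OF p] F.projections_closed[OF q] by (metis (mono_tags) CollectD subsetD)
    then show ?thesis using F.munn_inj_on_projections p q by (simp add: inj_on_eq_iff)
  qed
  have h_inj: "inj_on h (carrier F)"
  proof
    fix a b assume a: "a \<in> carrier F" and b: "b \<in> carrier F" and eq: "h a = h b"
    let ?G = "inv_of_group G"
    from FIR_universal[OF M R inverse_monoid_inv_of_group[OF assms(2)]
        R_premorphism_group[OF M assms(2,3) R assms(6)]]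
    obtain \<sigma> where \<sigma>: "\<sigma> \<in> restr_hom S (restr_of_inv ?G)"
      and \<sigma>\<iota>: "\<And>m. m \<in> carrier M \<Longrightarrow> \<sigma> (\<iota> m) = \<epsilon> m"
      unfolding S_def I_def \<iota>_def by blast
    note \<sigma>D = restr_homD[OF \<sigma>]
    interpret G: group G by (rule assms(2))
    have \<sigma>h: "\<sigma> (h c) = \<epsilon> m" if c: "c \<in> carrier F" and m: "m \<in> carrier M" and "c = c\<^sup>\<oplus>\<^bsub>F\<^esub> \<otimes>\<^bsub>F\<^esub> \<beta> m" for c m
    proof -
      have \<iota>S: "\<iota> m \<in> carrier S" using \<iota>c[OF m] by (simp add: S_simps)
      have "\<sigma> (h c) = \<sigma> (h (c\<^sup>\<oplus>\<^bsub>F\<^esub> \<otimes>\<^bsub>F\<^esub> \<beta> m))" using that(3) by simp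
      also have "\<dots> = (\<sigma> (h c))\<^sup>\<oplus>\<^bsub>restr_of_inv ?G\<^esub> \<otimes>\<^bsub>G\<^esub> \<epsilon> m"
        using c m \<beta>c \<iota>S
        by (simp add: hD \<sigma>D F.plus_closed S.plus_closed h\<beta> \<sigma>\<iota>)
          (simp add: restr_of_inv_def inv_of_group_def)
      also have "\<dots> = \<epsilon> m"
        using \<sigma>D(1)[OF hD(1)[OF c]] m assms(3) by (auto simp: restr_of_inv_def inv_of_group_def hom_def Pi_iff)
      finally show ?thesis .
    qed
    obtain m n where m: "m \<in> carrier M" "a = a\<^sup>\<oplus>\<^bsub>F\<^esub> \<otimes>\<^bsub>F\<^esub> \<beta> m"
      and n: "n \<in> carrier M" "b = b\<^sup>\<oplus>\<^bsub>F\<^esub> \<otimes>\<^bsub>F\<^esub> \<beta> n"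
      using F_dec[OF a] F_dec[OF b] by (elim bexE)
    \<comment> \<open>Elements with equal images thus have the same generator by injectivity of
      \<open>\<epsilon>\<close>, and the same plus by \<open>h_inj_proj\<close>; together these
      determine the element.\<close>
    have "\<epsilon> m = \<epsilon> n" using \<sigma>h[OF a m] \<sigma>h[OF b n] eq by simp
    then have "m = n" using assms(4) m(1) n(1) by (simp add: inj_on_eq_iff)
    moreover have "a\<^sup>\<oplus>\<^bsub>F\<^esub> = b\<^sup>\<oplus>\<^bsub>F\<^esub>"
      using h_inj_proj[OF F.plus_projection[OF a] F.plus_projection[OF b]] a b eq by (simp add: hD)
    ultimately show "a = b" using m(2) n(2) by simp
  qed
  have "h \<in> restr_hom F (S\<lparr>carrier := T\<rparr>)"
    using h h_image by (auto simp: restr_hom_def hom_def)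
  then have "restr_isomorphic F (S\<lparr>carrier := T\<rparr>)"
    unfolding restr_isomorphic_def using h_inj h_image by (auto simp: bij_betw_def)
  then show ?thesis
    using T T_restr T_mon unfolding Let_def T_def F_def S_def I_def \<iota>_def by blast
qed

end
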